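(* Let $K=P(n_1,\dots,n_k)$ be a pretzel knot with its standard diagram $D$, oriented, with $n=|n_1|+\dots+|n_k|$ crossings numbered $1,\dots,n$ as described in the context, and let $\Gamma$ be the balanced overlaid Tait graph obtained by omitting the unbounded region $U$ and the upper deck $R_{\mathrm{top}}$. Let $M$ be the $n\times n$ signed enhanced activity matrix: rows indexed by the crossings $1,\dots,n$, columns indexed by the $n$ regions other than $U$ and $R_{\mathrm{top}}$ (in any order), with entry $M_{c,R}=0$ if $R$ is not incident with crossing $c$, and otherwise $$M_{c,R}=\kappa(c,R)\,w(c)\,\alpha(c,R)|_V,$$ where $\alpha(c,R)$ is the activity letter of the edge of $\Gamma$ joining $c$ and $R$, $\alpha|_V$ is its evaluation given in the context, $w(c)=-A^{-3}$ if $c$ is a positive crossing of the oriented diagram (writhe contribution $+1$) and $w(c)=-A^{3}$ if it is negative, and $\kappa(c,R)=-1$ if $R$ is the region at $c$ lying between the two outgoing strand-ends of $c$ and $\kappa(c,R)=+1$ otherwise. Then, with $A=t^{-1/4}$, $$\det(M)=\pm V_K(t),$$ the Jones polynomial of $K$, up to sign.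
   Context: Pretzel diagram: for nonzero integers $n_1,\dots,n_k$, the diagram of $P(n_1,\dots,n_k)$ consists of $k$ vertical twist columns placed left to right, column $i$ being $|n_i|$ crossings between two strands stacked vertically; for $1\le i<k$ the top-right endpoint of column $i$ is joined to the top-left endpoint of column $i+1$ by a short arc, and likewise at the bottom; the top-left endpoint of column 1 is joined to the top-right endpoint of column $k$ by an arc passing above everything, and likewise at the bottom. $K$ is assumed to be a knot. Regions: the unbounded region $U$; the upper deck $R_{\mathrm{top}}$ (bounded by the upper outer arc and the tops of the columns and the top short arcs); the lower deck $R_{\mathrm{bot}}$; the $|n_i|-1$ regions inside column $i$ between consecutive crossings; and for $1\le i<k$ the region $W_i$ between columns $i$ and $i+1$. Black regions: $R_{\mathrm{top}},R_{\mathrm{bot}}$ and the regions inside columns; white regions: $U,W_1,\dots,W_{k-1}$. Crossings are numbered: column 1 top to bottom, then column 2 bottom to top, then each subsequent column bottom to top. Tait sign of a crossing: viewing it with the two black regions above and below, it is positive if the overstrand runs from lower left to upper right and negative otherwise; by convention the sign of $n_i$ is the Tait sign of the crossings of column $i$. Activity letter $\alpha(c,R)$ for crossing $c$ and incident non-omitted region $R$: internal ($L$ or $D$) if $R$ is black, external ($\ell$ or $d$) if $R$ is white; live ($L$ or $\ell$) if $c$ is the lowest-numbered crossing incident with $R$, dead ($D$ or $d$) otherwise; barred ($\overline{L},\overline{D},\overline{\ell},\overline{d}$) if $c$ has negative Tait sign. Evaluations $\alpha|_V$: $L\mapsto -A^{-3}$, $D\mapsto A$, $\ell\mapsto -A^{3}$,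 $d\mapsto A^{-1}$, $\overline{L}\mapsto -A^{3}$, $\overline{D}\mapsto A^{-1}$, $\overline{\ell}\mapsto -A^{-3}$, $\overline{d}\mapsto A$. Writhe sign of an oriented crossing is the usual $\pm1$ (right-handed crossing $+1$). $V_K(t)$ is the Jones polynomial (normalized so that the unknot has $V=1$). *)

theory Defs
  imports Complex_Main "Jordan_Normal_Form.Determinant"
begin

text \<open>The pretzel diagram is encoded by the list ns = [n_1,...,n_k] of nonzero integers.
 Columns are indexed 0..k-1 (left to right); the crossings of column i are indexed
 (i,j) with j = 0..|n_i|-1, j = 0 being the top crossing.  Every crossing is drawn
 with its four ends at the corners NW, NE, SW, SE; the strands through a crossing are
 NW--SE and NE--SW.  The four regions around crossing (i,j) are: north and south
 (black: the upper deck, the lower deck or a region inside the column), west and east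
 (white: the unbounded region U or a region W_i between two columns).\<close>

datatype corner = NW | NE | SW | SE

datatype region = U | Rtop | Rbot | Inner nat nat | Wreg nat
  \<comment> \<open>Inner i j: region in column i between crossings j and j+1;
      Wreg i: region between columns i and i+1\<close>

type_synonym crossing = "nat \<times> nat"
type_synonym dend = "crossing \<times> corner"

definition col_len :: "int list \<Rightarrow> nat \<Rightarrow> nat" where
  "col_len ns i = nat \<bar>ns ! i\<bar>"

definition pcrossings :: "int list \<Rightarrow> crossing set" where
  "pcrossings ns = {(i, j). i < length ns \<and> j < col_len ns i}"

definition ncross :: "int list \<Rightarrow> nat" where
  "ncross ns = sum_list (map (\<lambda>x. nat \<bar>x\<bar>) ns)"

text \<open>Crossing numbering (0-based): column 1 top to bottom, then every further column
 bottom to top.\<close>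
definition cnum :: "int list \<Rightarrow> crossing \<Rightarrow> nat" where
  "cnum ns c = (if fst c = 0 then snd c
     else sum_list (map (\<lambda>x. nat \<bar>x\<bar>) (take (fst c) ns)) + (col_len ns (fst c) - 1 - snd c))"

definition north :: "int list \<Rightarrow> crossing \<Rightarrow> region" where
  "north ns c = (if snd c = 0 then Rtop else Inner (fst c) (snd c - 1))"

definition south :: "int list \<Rightarrow> crossing \<Rightarrow> region" where
  "south ns c = (if snd c = col_len ns (fst c) - 1 then Rbot else Inner (fst c) (snd c))"

definition west :: "int list \<Rightarrow> crossing \<Rightarrow> region" where
  "west ns c = (if fst c = 0 then U else Wreg (fst c - 1))"

definition east :: "int list \<Rightarrow> crossing \<Rightarrow> region" where
  "east ns c = (if fst c = length ns - 1 then U else Wreg (fst c))"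

definition incident :: "int list \<Rightarrow> crossing \<Rightarrow> region \<Rightarrow> bool" where
  "incident ns c R \<longleftrightarrow> R \<in> {north ns c, south ns c, west ns c, east ns c}"

definition free_regions :: "int list \<Rightarrow> region set" where
  "free_regions ns = {R. \<exists>c\<in>pcrossings ns. incident ns c R} - {U, Rtop}"

fun is_black :: "region \<Rightarrow> bool" where
  "is_black U = False"
| "is_black Rtop = True"
| "is_black Rbot = True"
| "is_black (Inner _ _) = True"
| "is_black (Wreg _) = False"

definition tait_pos :: "int list \<Rightarrow> crossing \<Rightarrow> bool" where
  "tait_pos ns c \<longleftrightarrow> ns ! fst c > 0"

definition dends :: "int list \<Rightarrow> dend set" where
  "dends ns = pcrossings ns \<times> UNIV"

definition parcs :: "int list \<Rightarrow> (dend \<times> dend) set" where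
  "parcs ns =
     {(((i, j), SW), ((i, Suc j), NW)) | i j. i < length ns \<and> Suc j < col_len ns i}
   \<union> {(((i, j), SE), ((i, Suc j), NE)) | i j. i < length ns \<and> Suc j < col_len ns i}
   \<union> {(((i, 0), NE), ((Suc i, 0), NW)) | i. Suc i < length ns}
   \<union> {(((i, col_len ns i - 1), SE), ((Suc i, col_len ns (Suc i) - 1), SW)) | i. Suc i < length ns}
   \<union> {(((0, 0), NW), ((length ns - 1, 0), NE)),
      (((0, col_len ns 0 - 1), SW), ((length ns - 1, col_len ns (length ns - 1) - 1), SE))}"

definition pthrough :: "int list \<Rightarrow> (dend \<times> dend) set" where
  "pthrough ns = {((c, NW), (c, SE)) | c. c \<in> pcrossings ns}
                \<union> {((c, NE), (c, SW)) | c. c \<in> pcrossings ns}"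

definition ncomp :: "'a set \<Rightarrow> ('a \<times> 'a) set \<Rightarrow> nat" where
  "ncomp E R = card (E // {(x, y). x \<in> E \<and> y \<in> E \<and> (x, y) \<in> (R \<union> R\<inverse>)\<^sup>*})"

definition pretzel_is_knot :: "int list \<Rightarrow> bool" where
  "pretzel_is_knot ns \<longleftrightarrow> ncomp (dends ns) (parcs ns \<union> pthrough ns) = 1"

text \<open>An orientation: out e holds iff the oriented strand leaves its crossing through
 the end e.\<close>
definition is_orientation :: "int list \<Rightarrow> (dend \<Rightarrow> bool) \<Rightarrow> bool" where
  "is_orientation ns out \<longleftrightarrow>
     (\<forall>c\<in>pcrossings ns. out (c, NW) \<noteq> out (c, SE) \<and> out (c, NE) \<noteq> out (c, SW)) \<and>
     (\<forall>(p, q)\<in>parcs ns. out p \<noteq> out q)"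

fun cpos :: "corner \<Rightarrow> int \<times> int" where
  "cpos NW = (-1, 1)" | "cpos NE = (1, 1)" | "cpos SW = (-1, -1)" | "cpos SE = (1, -1)"

definition sdir :: "(dend \<Rightarrow> bool) \<Rightarrow> crossing \<Rightarrow> corner \<Rightarrow> corner \<Rightarrow> int \<times> int" where
  "sdir out c e1 e2 = (if out (c, e1)
      then (fst (cpos e1) - fst (cpos e2), snd (cpos e1) - snd (cpos e2))
      else (fst (cpos e2) - fst (cpos e1), snd (cpos e2) - snd (cpos e1)))"

text \<open>Over strand: SW--NE for positive Tait sign, NW--SE otherwise.  A crossing is
 positive (right-handed, writhe +1) iff (over direction) x (under direction) > 0.\<close>
definition writhe_pos :: "int list \<Rightarrow> (dend \<Rightarrow> bool) \<Rightarrow> crossing \<Rightarrow> bool" where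
  "writhe_pos ns out c \<longleftrightarrow>
     (let a = sdir out c NE SW; b = sdir out c NW SE;
          ov = (if tait_pos ns c then a else b); un = (if tait_pos ns c then b else a)
      in fst ov * snd un - snd ov * fst un > 0)"

definition pwrithe :: "int list \<Rightarrow> (dend \<Rightarrow> bool) \<Rightarrow> int" where
  "pwrithe ns out = (\<Sum>c\<in>pcrossings ns. if writhe_pos ns out c then 1 else -1)"

definition out_region :: "int list \<Rightarrow> (dend \<Rightarrow> bool) \<Rightarrow> crossing \<Rightarrow> region" where
  "out_region ns out c =
     (if out (c, NW) then (if out (c, NE) then north ns c else west ns c)
      else (if out (c, NE) then east ns c else south ns c))"

definition pstates :: "int list \<Rightarrow> (crossing \<Rightarrow> bool) set" where
  "pstates ns = Pi\<^sub>E (pcrossings ns) (\<lambda>_. UNIV)"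

text \<open>s c = True means A-smoothing at c.  The A-smoothing merges the two A-regions
 (swept by turning the overstrand counterclockwise); for positive Tait sign these are
 north and south.  Merging north/south joins NW--SW and NE--SE; merging west/east joins
 NW--NE and SW--SE.\<close>
definition smooth_rel :: "int list \<Rightarrow> (crossing \<Rightarrow> bool) \<Rightarrow> (dend \<times> dend) set" where
  "smooth_rel ns s =
     {((c, NW), (c, SW)) | c. c \<in> pcrossings ns \<and> s c = tait_pos ns c}
   \<union> {((c, NE), (c, SE)) | c. c \<in> pcrossings ns \<and> s c = tait_pos ns c}
   \<union> {((c, NW), (c, NE)) | c. c \<in> pcrossings ns \<and> s c \<noteq> tait_pos ns c}
   \<union> {((c, SW), (c, SE)) | c. c \<in> pcrossings ns \<and> s c \<noteq> tait_pos ns c}"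

definition state_loops :: "int list \<Rightarrow> (crossing \<Rightarrow> bool) \<Rightarrow> nat" where
  "state_loops ns s = ncomp (dends ns) (parcs ns \<union> smooth_rel ns s)"

definition kbracket :: "int list \<Rightarrow> complex \<Rightarrow> complex" where
  "kbracket ns A = (\<Sum>s\<in>pstates ns.
      A powi (int (card {c\<in>pcrossings ns. s c}) - int (card {c\<in>pcrossings ns. \<not> s c}))
      * (- (A ^ 2) - inverse (A ^ 2)) ^ (state_loops ns s - 1))"

text \<open>Jones polynomial V_K evaluated at t = A^(-4): (-A^3)^(-w(D)) <D>, with <O> = 1.\<close>
definition jones_A :: "int list \<Rightarrow> (dend \<Rightarrow> bool) \<Rightarrow> complex \<Rightarrow> complex" where
  "jones_A ns out A = (- (A ^ 3)) powi (- pwrithe ns out) * kbracket ns A"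

definition is_live :: "int list \<Rightarrow> crossing \<Rightarrow> region \<Rightarrow> bool" where
  "is_live ns c R \<longleftrightarrow> cnum ns c = Min (cnum ns ` {c' \<in> pcrossings ns. incident ns c' R})"

text \<open>Evaluation of the activity letter: L,D,l,d for positive Tait sign;
 barred letters (A replaced by A^(-1)) for negative Tait sign.\<close>
definition alpha_val :: "int list \<Rightarrow> crossing \<Rightarrow> region \<Rightarrow> complex \<Rightarrow> complex" where
  "alpha_val ns c R A =
     (let B = (if tait_pos ns c then A else inverse A) in
      if is_black R then (if is_live ns c R then - (B powi (-3)) else B)
      else (if is_live ns c R then - (B ^ 3) else inverse B))"

definition w_val :: "int list \<Rightarrow> (dend \<Rightarrow> bool) \<Rightarrow> crossing \<Rightarrow> complex \<Rightarrow> complex" where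
  "w_val ns out c A = (if writhe_pos ns out c then - (A powi (-3)) else - (A ^ 3))"

definition kappa :: "int list \<Rightarrow> (dend \<Rightarrow> bool) \<Rightarrow> crossing \<Rightarrow> region \<Rightarrow> complex" where
  "kappa ns out c R = (if R = out_region ns out c then -1 else 1)"

definition act_entry :: "int list \<Rightarrow> (dend \<Rightarrow> bool) \<Rightarrow> complex \<Rightarrow> crossing \<Rightarrow> region \<Rightarrow> complex" where
  "act_entry ns out A c R =
     (if incident ns c R then kappa ns out c R * w_val ns out c A * alpha_val ns c R A else 0)"

definition crossing_of_num :: "int list \<Rightarrow> nat \<Rightarrow> crossing" where
  "crossing_of_num ns r = (THE c. c \<in> pcrossings ns \<and> cnum ns c = r)"

definition act_matrix :: "int list \<Rightarrow> (dend \<Rightarrow> bool) \<Rightarrow> (nat \<Rightarrow> region) \<Rightarrow> complex \<Rightarrow> complex mat" where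
  "act_matrix ns out \<sigma> A =
     mat (ncross ns) (ncross ns) (\<lambda>(r, k). act_entry ns out A (crossing_of_num ns r) (\<sigma> k))"

end

theory Submission
  imports Defs
begin

text \<open>
  Write \<open>a\<close> for \<open>A\<close> or \<open>1/A\<close> according to the Tait sign of a column with \<open>m\<close> crossings and
  \<open>d = -A^2 - A^(-2)\<close>. Smoothing a whole column contributes either two vertical strands, with weight
  \<open>X = a^m\<close>, or a cup and a cap, with weight \<open>Y\<close> such that \<open>(-a^(-3))^m = X + d Y\<close>. Counting the
  loops of a state gives
  \<open>d * prod_i Y_i + sum_t (prod_(j<t) (Y_j + d X_j)) X_t (prod_(j>t) Y_j)\<close> for the bracket, where \<open>t\<close> is
  the last column smoothed vertically.

  On the other side, the product of the \<open>w(c)\<close> is the writhe factor, and the signs \<open>\<kappa>\<close> satisfy the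
  Kasteleyn condition at every arc of the diagram: of the two regions beside an arc, exactly one is
  the outgoing region at the tail and none is at the head. Hence \<open>\<kappa>\<close> agrees, up to signs of
  rows and columns, with the signs that are -1 at north and west and +1 at south and east. With
  those signs, eliminating the inner regions column by column leaves a matrix of size \<open>k\<close> whose
  \<open>i\<close>-th row has the entries \<open>X_i\<close> (plus \<open>d Y_0\<close> for \<open>i = 0\<close>), \<open>-Y_i\<close>, \<open>Y_i + d X_i\<close> at
  \<open>Rbot\<close>, \<open>Wreg (i-1)\<close>, \<open>Wreg i\<close>; a second elimination gives the sum above.
\<close>

section \<open>Determinants over finite index sets\<close>

text \<open>The index set is an arbitrary finite set, so eliminating a row and a column just removes
  an element and nothing has to be renumbered.\<close>

definition leibniz_det :: "'a set \<Rightarrow> ('a \<Rightarrow> 'a \<Rightarrow> 'b::comm_ring_1) \<Rightarrow> 'b" where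
  "leibniz_det S F = (\<Sum>p | p permutes S. of_int (sign p) * (\<Prod>x\<in>S. F x (p x)))"

lemma leibniz_det_cong:
  assumes "\<And>x y. x \<in> S \<Longrightarrow> y \<in> S \<Longrightarrow> F x y = G x y"
  shows "leibniz_det S F = leibniz_det S G"
  unfolding leibniz_det_def
proof (rule sum.cong[OF refl])
  fix p assume "p \<in> {p. p permutes S}"
  then have "p permutes S" by simp
  then have "(\<Prod>x\<in>S. F x (p x)) = (\<Prod>x\<in>S. G x (p x))"
    by (intro prod.cong refl assms) (simp_all add: permutes_in_image)
  then show "of_int (sign p) * (\<Prod>x\<in>S. F x (p x)) = of_int (sign p) * (\<Prod>x\<in>S. G x (p x))"
    by simp
qed

lemma leibniz_det_singleton [simp]: "leibniz_det {x} F = F x x"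
  by (simp add: leibniz_det_def)

lemma leibniz_det_scale:
  "leibniz_det S (\<lambda>x y. f x * g y * F x y) = (\<Prod>x\<in>S. f x * g x) * leibniz_det S F"
proof -
  have "(\<Prod>x\<in>S. f x * g (p x) * F x (p x)) = (\<Prod>x\<in>S. f x * g x) * (\<Prod>x\<in>S. F x (p x))"
    if "p permutes S" for p
  proof -
    have "(\<Prod>x\<in>S. g (p x)) = (\<Prod>x\<in>S. g x)"
      using prod.permute[OF that, of g] by (simp add: o_def)
    then show ?thesis by (simp add: prod.distrib)
  qed
  then show ?thesis
    unfolding leibniz_det_def sum_distrib_left
    by (intro sum.cong refl) (simp add: algebra_simps)
qed

text \<open>Column \<open>c'\<close> is nonzero at most in rows \<open>c\<close> and
  \<open>c'\<close>, so a contributing permutation either fixes \<open>c'\<close> or sends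
  \<open>c\<close> to \<open>c'\<close>. The second kind is the first composed with the
  transposition of \<open>c\<close> and \<open>c'\<close>, with opposite sign, and the paired terms
  form a 2 x 2 minor in row \<open>c\<close>. There is no division, so vanishing pivots do no
  harm.\<close>

lemma leibniz_det_condense:
  fixes F :: "'a \<Rightarrow> 'a \<Rightarrow> 'b::comm_ring_1"
  assumes fin: "finite S" and c: "c \<in> S" "c' \<in> S" "c \<noteq> c'"
    and zero: "\<And>x. x \<in> S \<Longrightarrow> x \<noteq> c \<Longrightarrow> x \<noteq> c' \<Longrightarrow> F x c' = 0"
  shows "leibniz_det S F =
    leibniz_det (S - {c'}) (F(c := \<lambda>y. F c' c' * F c y - F c c' * F c' y))"
proof -
  define T where "T = S - {c'}"
  define R where "R = T - {c}"
  let ?t = "\<lambda>p. of_int (sign p) * (\<Prod>x\<in>S. F x (p x))"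
  have finT: "finite T" "finite R" using fin by (auto simp: T_def R_def)
  have S: "S = insert c' (insert c R)" "c' \<notin> insert c R" "c \<notin> R" "T = insert c R"
    using c by (auto simp: T_def R_def)
  let ?P = "{p. p permutes T}"
  let ?tr = "Transposition.transpose c c'"
  let ?Q = "(\<lambda>q. q \<circ> ?tr) ` ?P"
  have fP: "finite ?P" using finT finite_permutations by auto
  have tr: "?tr permutes S" using c by (simp add: permutes_swap_id)
  have PS: "p permutes S" if "p permutes T" for p
    using that by (rule permutes_subset) (auto simp: T_def)
  have c'P: "p c' = c'" if "p permutes T" for p
    using that by (auto simp: permutes_def T_def)
  have trtr: "q \<circ> ?tr \<circ> ?tr = q" for q :: "'a \<Rightarrow> 'a" by (simp add: o_assoc[symmetric])
  have sub: "?P \<union> ?Q \<subseteq> {p. p permutes S}"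
    using PS permutes_compose[OF tr] by auto
  \<comment> \<open>Such a permutation takes its entry in column \<open>c'\<close> from a row other
    than \<open>c\<close> and \<open>c'\<close>, where it is 0.\<close>
  have other: "?t p = 0" if p: "p permutes S" "p \<notin> ?P \<union> ?Q" for p
  proof -
    obtain x where x: "x \<in> S" "p x = c'" using p c by (metis permutes_image imageE)
    have "x \<noteq> c'"
    proof
      assume "x = c'"
      then have "p permutes T" using p(1) x unfolding permutes_def T_def by auto
      then show False using p by auto
    qed
    moreover have "x \<noteq> c"
    proof
      assume xc: "x = c"
      let ?q = "p \<circ> ?tr"
      have q: "?q permutes S" using permutes_compose[OF tr p(1)] .
      have "?q c' = c'" using xc x by simp
      then have "?q permutes T" using q unfolding permutes_def T_def by auto
      moreover have "p = ?q \<circ> ?tr" by (simp add: trtr)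
      ultimately have "p \<in> ?Q" by blast
      then show False using p by auto
    qed
    ultimately have "F x (p x) = 0" using zero x by auto
    then have "(\<Prod>x\<in>S. F x (p x)) = 0" using x fin by (intro prod_zero) auto
    then show ?thesis by simp
  qed
  have disj: "?P \<inter> ?Q = {}"
  proof -
    have False if "q permutes T" "(q \<circ> ?tr) permutes T" for q
    proof -
      have "q c = c'" using c'P[OF that(2)] by simp
      moreover have "q c' = c'" using c'P[OF that(1)] .
      ultimately show False using that(1) c(3) by (metis permutes_inv_eq)
    qed
    then show ?thesis by auto
  qed
  have inj: "inj_on (\<lambda>q. q \<circ> ?tr) ?P"
    by (rule inj_on_inverseI[of _ "\<lambda>q. q \<circ> ?tr"]) (simp add: trtr)
  have "leibniz_det S F = sum ?t (?P \<union> ?Q)"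
    unfolding leibniz_det_def
    by (rule sum.mono_neutral_right) (use sub other fin in \<open>auto simp: finite_permutations\<close>)
  also have "\<dots> = sum ?t ?P + sum ?t ?Q"
    by (rule sum.union_disjoint) (use fP disj in auto)
  also have "sum ?t ?Q = (\<Sum>q\<in>?P. ?t (q \<circ> ?tr))"
    using inj by (simp add: sum.reindex)
  also have "sum ?t ?P + \<dots> = (\<Sum>q\<in>?P. ?t q + ?t (q \<circ> ?tr))"
    by (simp add: sum.distrib)
  also have "\<dots> = (\<Sum>q\<in>?P. of_int (sign q) *
      (\<Prod>x\<in>T. (F(c := \<lambda>y. F c' c' * F c y - F c c' * F c' y)) x (q x)))"
  proof (rule sum.cong[OF refl])
    fix q assume "q \<in> ?P"
    then have q: "q permutes T" by simp
    have sg: "sign (q \<circ> ?tr) = - sign q"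
    proof -
      have "permutation q" "permutation ?tr"
        using PS[OF q] tr fin by (auto simp: permutation_permutes)
      then show ?thesis using c(3) by (simp add: sign_compose sign_swap_id)
    qed
    have 1: "(\<Prod>x\<in>S. F x (q x)) = F c' c' * (F c (q c) * (\<Prod>x\<in>R. F x (q x)))"
      using S finT c'P[OF q] by simp
    have "(\<Prod>x\<in>R. F x ((q \<circ> ?tr) x)) = (\<Prod>x\<in>R. F x (q x))"
      using S by (intro prod.cong refl) (metis comp_apply insertCI transpose_apply_other)
    then have 2: "(\<Prod>x\<in>S. F x ((q \<circ> ?tr) x)) = F c' (q c) * (F c c' * (\<Prod>x\<in>R. F x (q x)))"
      using S finT c'P[OF q] by simp
    have "(\<Prod>x\<in>R. (F(c := \<lambda>y. F c' c' * F c y - F c c' * F c' y)) x (q x)) = (\<Prod>x\<in>R. F x (q x))"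
      using S by (intro prod.cong refl) auto
    then have 3: "(\<Prod>x\<in>T. (F(c := \<lambda>y. F c' c' * F c y - F c c' * F c' y)) x (q x)) =
      (F c' c' * F c (q c) - F c c' * F c' (q c)) * (\<Prod>x\<in>R. F x (q x))"
      using S finT by simp
    show "?t q + ?t (q \<circ> ?tr) = of_int (sign q) *
      (\<Prod>x\<in>T. (F(c := \<lambda>y. F c' c' * F c y - F c c' * F c' y)) x (q x))"
      unfolding 1 2 3 sg by (simp add: algebra_simps)
  qed
  finally show ?thesis by (simp add: leibniz_det_def T_def)
qed

text \<open>Repeated condensation into row \<open>e 0\<close>. When column \<open>e (Suc m)\<close>
  is reached, row \<open>e m\<close> is already absorbed in row \<open>e 0\<close>, so only rows
  \<open>e 0\<close> and \<open>e (Suc m)\<close> meet that column. Row \<open>e t\<close> collects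
  \<open>q j\<close> for j < t and \<open>p j\<close> for j > t.\<close>

lemma leibniz_det_chain:
  fixes F :: "'a \<Rightarrow> 'a \<Rightarrow> 'b::comm_ring_1" and e :: "nat \<Rightarrow> 'a"
  assumes fin: "finite S" and inj: "inj_on e {..m}" and mem: "e ` {..m} \<subseteq> S"
    and diag: "\<And>j. j \<in> {1..m} \<Longrightarrow> F (e j) (e j) = - p j"
    and sup: "\<And>j. j < m \<Longrightarrow> F (e j) (e (Suc j)) = q j"
    and zero: "\<And>j x. j \<in> {1..m} \<Longrightarrow> x \<in> S \<Longrightarrow> x \<noteq> e (j - 1) \<Longrightarrow> x \<noteq> e j \<Longrightarrow> F x (e j) = 0"
  shows "leibniz_det S F = leibniz_det (S - e ` {1..m})
    (F(e 0 := \<lambda>y. (-1) ^ m * (\<Sum>t\<le>m. (\<Prod>j<t. q j) * (\<Prod>j\<in>{t<..m}. p j) * F (e t) y)))"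
  using inj mem diag sup zero
proof (induction m)
  case 0
  then show ?case by simp
next
  case (Suc m)
  define G where "G = F(e 0 := \<lambda>y. (-1) ^ m * (\<Sum>t\<le>m. (\<Prod>j<t. q j) * (\<Prod>j\<in>{t<..m}. p j) * F (e t) y))"
  have injD: "e i = e j \<longleftrightarrow> i = j" if "i \<le> Suc m" "j \<le> Suc m" for i j
    using Suc.prems(1) that by (auto simp: inj_on_def)
  have IH: "leibniz_det S F = leibniz_det (S - e ` {1..m}) G"
    unfolding G_def
    by (rule Suc.IH) (use Suc.prems in \<open>auto intro: inj_on_subset\<close>)
  have mem: "e 0 \<in> S - e ` {1..m}" "e (Suc m) \<in> S - e ` {1..m}"
    using Suc.prems(2) by (auto simp: injD)
  have zero: "G x (e (Suc m)) = 0"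
    if "x \<in> S - e ` {1..m}" "x \<noteq> e 0" "x \<noteq> e (Suc m)" for x
  proof -
    \<comment> \<open>For \<open>m > 0\<close> the row \<open>e m\<close> has been removed; for
      \<open>m = 0\<close> it is \<open>e 0\<close>.\<close>
    have "x \<noteq> e m"
      using that by (cases m) auto
    then have "F x (e (Suc m)) = 0" using Suc.prems(5)[of "Suc m" x] that by auto
    then show ?thesis using that by (simp add: G_def)
  qed
  have G1: "G (e (Suc m)) = F (e (Suc m))" by (auto simp: G_def injD)
  \<comment> \<open>Of the rows absorbed so far only \<open>e m\<close> meets the new
    column.\<close>
  have "F (e t) (e (Suc m)) = 0" if "t < m" for t
  proof (rule Suc.prems(5))
    show "e t \<in> S" using Suc.prems(2) that by auto
  qed (use that in \<open>auto simp: injD\<close>)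
  then have "(\<Sum>t\<le>m. (\<Prod>j<t. q j) * (\<Prod>j\<in>{t<..m}. p j) * F (e t) (e (Suc m))) =
     (\<Prod>j<m. q j) * F (e m) (e (Suc m))"
    by (subst sum.mono_neutral_right[of _ "{m}"]) auto
  then have G0: "G (e 0) (e (Suc m)) = (-1) ^ m * (\<Prod>j<Suc m. q j)"
    using Suc.prems(4)[of m] by (simp add: G_def)
  have row: "G (e (Suc m)) (e (Suc m)) * G (e 0) y - G (e 0) (e (Suc m)) * G (e (Suc m)) y =
     (-1) ^ Suc m * (\<Sum>t\<le>Suc m. (\<Prod>j<t. q j) * (\<Prod>j\<in>{t<..Suc m}. p j) * F (e t) y)" for y
  proof -
    have "(\<Sum>t\<le>m. (\<Prod>j<t. q j) * (\<Prod>j\<in>{t<..Suc m}. p j) * F (e t) y) =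
          p (Suc m) * (\<Sum>t\<le>m. (\<Prod>j<t. q j) * (\<Prod>j\<in>{t<..m}. p j) * F (e t) y)"
      unfolding sum_distrib_left
    proof (rule sum.cong[OF refl])
      fix t assume "t \<in> {..m}"
      then have "{t<..Suc m} = insert (Suc m) {t<..m}" by auto
      then show "(\<Prod>j<t. q j) * (\<Prod>j\<in>{t<..Suc m}. p j) * F (e t) y =
        p (Suc m) * ((\<Prod>j<t. q j) * (\<Prod>j\<in>{t<..m}. p j) * F (e t) y)"
        by (simp add: algebra_simps)
    qed
    moreover have "G (e (Suc m)) (e (Suc m)) = - p (Suc m)"
      using G1 Suc.prems(3)[of "Suc m"] by simp
    ultimately show ?thesis
      unfolding G0 by (simp add: G1) (simp add: G_def algebra_simps)
  qed
  have "leibniz_det (S - e ` {1..m}) G = leibniz_det (S - e ` {1..m} - {e (Suc m)})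
     (G(e 0 := \<lambda>y. G (e (Suc m)) (e (Suc m)) * G (e 0) y - G (e 0) (e (Suc m)) * G (e (Suc m)) y))"
    by (rule leibniz_det_condense) (use fin mem zero in \<open>auto simp: injD\<close>)
  moreover have "S - e ` {1..m} - {e (Suc m)} = S - e ` {1..Suc m}"
    by (auto simp: atLeastAtMostSuc_conv)
  moreover have "G(e 0 := r) = F(e 0 := r)" for r by (simp add: G_def)
  ultimately show ?case unfolding IH row by (simp only:)
qed

text \<open>With \<open>S\<close> and \<open>T\<close> identified by \<open>\<rho>\<close>, the two
  enumerations differ by a permutation of the indices, whose sign is s. The same s works for every
  \<open>F\<close>, which later makes the sign of the theorem independent of
  \<open>A\<close>.\<close>

lemma det_mat_eq_leibniz_det:
  assumes c: "bij_betw c {..<n} S" and r: "bij_betw r {..<n} T" and \<rho>: "bij_betw \<rho> S T"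
  shows "\<exists>s\<in>{1, -1 :: 'c::comm_ring_1}. \<forall>F.
    det (mat n n (\<lambda>(i, j). F (c i) (r j))) = s * leibniz_det S (\<lambda>x y. F x (\<rho> y))"
proof -
  let ?N = "{..<n}"
  \<comment> \<open>Chosen so that \<open>r j = \<rho> (c (\<tau> j))\<close>;
    \<open>restrict_id\<close> makes it the identity outside \<open>?N\<close>, as
    \<open>permutes\<close> demands.\<close>
  define \<tau> where "\<tau> = restrict_id (inv_into ?N (\<rho> \<circ> c) \<circ> r) ?N"
  have rc: "bij_betw (\<rho> \<circ> c) ?N T" using c \<rho> by (rule bij_betw_trans)
  have b: "bij_betw (inv_into ?N (\<rho> \<circ> c) \<circ> r) ?N ?N"
    using r bij_betw_inv_into[OF rc] by (rule bij_betw_trans)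
  have \<tau>: "\<tau> permutes ?N"
  proof (rule bij_imp_permutes)
    show "bij_betw \<tau> ?N ?N" unfolding \<tau>_def by (rule bij_betw_restrict_id[OF b]) simp
  qed (simp add: \<tau>_def)
  have rt: "r j = \<rho> (c (\<tau> j))" if "j < n" for j
  proof -
    have "r j \<in> (\<rho> \<circ> c) ` ?N" using r rc that by (auto simp: bij_betw_def)
    then have "(\<rho> \<circ> c) (inv_into ?N (\<rho> \<circ> c) (r j)) = r j" by (rule f_inv_into_f)
    then show ?thesis using that by (simp add: \<tau>_def)
  qed
  have finS: "finite S" using c bij_betw_finite by blast
  have p\<tau>: "permutation \<tau>" using \<tau> by (auto simp: permutation_permutes)
  have "det (mat n n (\<lambda>(i, j). F (c i) (r j))) = of_int (sign \<tau>) * leibniz_det S (\<lambda>x y. F x (\<rho> y))"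
    for F :: "_ \<Rightarrow> _ \<Rightarrow> 'c"
  proof -
    let ?f = "\<lambda>p. of_int (sign p) * (\<Prod>i<n. F (c i) (\<rho> (c (p i))))"
    have "det (mat n n (\<lambda>(i, j). F (c i) (r j))) =
       (\<Sum>p | p permutes ?N. of_int (sign \<tau>) * ?f (\<tau> \<circ> p))"
      unfolding det_def dim_row_mat dim_col_mat atLeast0LessThan if_P[OF refl]
    proof (rule sum.cong[OF refl])
      fix p assume "p \<in> {p. p permutes ?N}"
      then have p: "p permutes ?N" by simp
      have "(\<Prod>i<n. mat n n (\<lambda>(i, j). F (c i) (r j)) $$ (i, p i)) = (\<Prod>i<n. F (c i) (\<rho> (c ((\<tau> \<circ> p) i))))"
        using permutes_in_image[OF p] by (intro prod.cong refl) (simp add: rt)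
      moreover have "sign (\<tau> \<circ> p) = sign \<tau> * sign p"
        using p p\<tau> by (intro sign_compose) (auto simp: permutation_permutes)
      then have "of_int (sign \<tau>) * of_int (sign (\<tau> \<circ> p)) = (of_int (sign p) :: 'c)"
        by (simp flip: of_int_mult)
      ultimately show "of_int (sign p) * (\<Prod>i<n. mat n n (\<lambda>(i, j). F (c i) (r j)) $$ (i, p i)) =
         of_int (sign \<tau>) * ?f (\<tau> \<circ> p)"
        by (simp only: mult.assoc[symmetric])
    qed
    also have "\<dots> = of_int (sign \<tau>) * (\<Sum>p | p permutes ?N. ?f p)"
      unfolding sum_distrib_left[symmetric]
      by (simp add: setum_permutations_compose_left[OF \<tau>, of ?f])
    also have "(\<Sum>p | p permutes ?N. ?f p) = leibniz_det S (\<lambda>x y. F x (\<rho> y))"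
      unfolding leibniz_det_def
    \<comment> \<open>Conjugation by \<open>c\<close> carries permutations of the indices to
      permutations of \<open>S\<close> and preserves the sign.\<close>
    proof (rule sum.reindex_bij_witness[of _ "map_permutation S (inv_into ?N c)" "map_permutation ?N c"])
      fix p assume "p \<in> {p. p permutes ?N}"
      then have p: "p permutes ?N" by simp
      have inj: "inj_on c ?N" and im: "c ` ?N = S" using c by (auto simp: bij_betw_def)
      show "map_permutation S (inv_into ?N c) (map_permutation ?N c p) = p"
        by (rule map_permutation_compose_inv[OF c p]) (simp add: inj)
      show "map_permutation ?N c p \<in> {p. p permutes S}"
        using map_permutation_permutes[OF c p] by simp
      have "(\<Prod>x\<in>S. F x (\<rho> (map_permutation ?N c p x))) = (\<Prod>i<n. F (c i) (\<rho> (c (p i))))"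
        unfolding im[symmetric] using inj
        by (simp add: prod.reindex map_permutation_apply)
      then show "of_int (sign (map_permutation ?N c p)) *
         (\<Prod>x\<in>S. F x (\<rho> (map_permutation ?N c p x))) = ?f p"
        using sign_map_permutation[OF inj p] by simp
    next
      fix p assume "p \<in> {p. p permutes S}"
      then have p: "p permutes S" by simp
      have ib: "bij_betw (inv_into ?N c) S ?N" using c by (rule bij_betw_inv_into)
      show "map_permutation ?N c (map_permutation S (inv_into ?N c) p) = p"
        by (rule map_permutation_compose_inv[OF ib p]) (metis c bij_betw_inv_into_right)
      show "map_permutation S (inv_into ?N c) p \<in> {p. p permutes ?N}"
        using map_permutation_permutes[OF ib p] by simp
    qed
    finally show ?thesis .
  qed
  moreover have "of_int (sign \<tau>) \<in> {1, -1 :: 'c}" by (cases \<tau> rule: sign_cases) auto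
  ultimately show ?thesis by (intro bexI[of _ "of_int (sign \<tau>)"] allI)
qed

section \<open>Crossings, regions and activities\<close>

locale pretzel =
  fixes ns :: "int list"
  assumes nonempty: "ns \<noteq> []" and nonzero: "\<forall>x\<in>set ns. x \<noteq> 0"
begin

lemma col_len_pos: "i < length ns \<Longrightarrow> 0 < col_len ns i"
  using nonzero by (auto simp: col_len_def)

lemma pcrossings_iff [simp]: "(i, j) \<in> pcrossings ns \<longleftrightarrow> i < length ns \<and> j < col_len ns i"
  by (simp add: pcrossings_def)

lemma pcrossings_Sigma: "pcrossings ns = Sigma {..<length ns} (\<lambda>i. {..<col_len ns i})"
  by auto

lemma finite_pcrossings [simp]: "finite (pcrossings ns)"
  by (simp add: pcrossings_Sigma)

lemma sum_list_take:
  "i \<le> length ns \<Longrightarrow> sum_list (map (\<lambda>x. nat \<bar>x\<bar>) (take i ns)) = (\<Sum>t<i. col_len ns t)"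
  by (induction i) (auto simp: take_Suc_conv_app_nth col_len_def)

lemma card_pcrossings: "card (pcrossings ns) = ncross ns"
  using sum_list_take[of "length ns"] by (simp add: pcrossings_Sigma ncross_def)

lemma cnum_eq:
  "i < length ns \<Longrightarrow> cnum ns (i, j) =
    (\<Sum>t<i. col_len ns t) + (if i = 0 then j else col_len ns i - 1 - j)"
  by (simp add: cnum_def sum_list_take)

lemma cnum_less_next:
  assumes "(i, j) \<in> pcrossings ns"
  shows "cnum ns (i, j) < (\<Sum>t<Suc i. col_len ns t)"
  using assms by (auto simp: cnum_eq)

lemma cnum_less:
  assumes "(i, j) \<in> pcrossings ns" "(i', j') \<in> pcrossings ns" "i < i'"
  shows "cnum ns (i, j) < cnum ns (i', j')"
proof -
  have "(\<Sum>t<Suc i. col_len ns t) \<le> (\<Sum>t<i'. col_len ns t)"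
    using assms by (intro sum_mono2) auto
  also have "\<dots> \<le> cnum ns (i', j')" using assms by (simp only: cnum_eq pcrossings_iff le_add1)
  finally show ?thesis using cnum_less_next[OF assms(1)] by simp
qed

lemma inj_on_cnum: "inj_on (cnum ns) (pcrossings ns)"
proof (rule inj_onI)
  fix c c' assume c: "c \<in> pcrossings ns" "c' \<in> pcrossings ns" "cnum ns c = cnum ns c'"
  obtain i j i' j' where [simp]: "c = (i, j)" "c' = (i', j')" by (cases c, cases c')
  have "i = i'" using c cnum_less[of i j i' j'] cnum_less[of i' j' i j] by (cases i i' rule: linorder_cases) auto
  then show "c = c'" using c by (auto simp: cnum_eq split: if_splits)
qed

lemma cnum_image: "cnum ns ` pcrossings ns = {..<ncross ns}"
proof (rule card_subset_eq)
  show "cnum ns ` pcrossings ns \<subseteq> {..<ncross ns}"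
  proof
    fix r assume "r \<in> cnum ns ` pcrossings ns"
    then obtain i j where ij: "(i, j) \<in> pcrossings ns" "r = cnum ns (i, j)" by auto
    have "(\<Sum>t<Suc i. col_len ns t) \<le> (\<Sum>t<length ns. col_len ns t)"
      using ij by (intro sum_mono2) auto
    then show "r \<in> {..<ncross ns}"
      using cnum_less_next[OF ij(1)] ij(2) sum_list_take[of "length ns"] by (simp add: ncross_def)
  qed
  show "card (cnum ns ` pcrossings ns) = card {..<ncross ns}"
    by (simp add: card_image inj_on_cnum card_pcrossings)
qed simp

lemma bij_crossing_of_num: "bij_betw (crossing_of_num ns) {..<ncross ns} (pcrossings ns)"
proof -
  have inv: "crossing_of_num ns (cnum ns c) = c" if "c \<in> pcrossings ns" for c
    unfolding crossing_of_num_def using that inj_on_cnum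
    by (intro the_equality) (auto simp: inj_on_def)
  have "bij_betw (cnum ns) (pcrossings ns) {..<ncross ns}"
    using inj_on_cnum cnum_image by (simp add: bij_betw_def)
  then show ?thesis
    by (rule bij_betw_cong[THEN iffD1, rotated, OF bij_betw_inv_into])
       (metis cnum_image f_inv_into_f inv inv_into_into)
qed

text \<open>Pairs each crossing with a region so that eliminating \<open>(i, j)\<close> with \<open>j > 0\<close> involves only the rows
  \<open>(i, j - 1)\<close> and \<open>(i, j)\<close>, and then eliminating \<open>(i, 0)\<close> only the rows \<open>(i - 1, 0)\<close> and \<open>(i, 0)\<close>.\<close>
definition region_of :: "crossing \<Rightarrow> region" where
  "region_of c = (if snd c > 0 then Inner (fst c) (snd c - 1)
     else if fst c = 0 then Rbot else Wreg (fst c - 1))"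

lemma incident_iff:
  "incident ns (i, j) Rbot \<longleftrightarrow> j = col_len ns i - 1"
  "incident ns (i, j) (Wreg w) \<longleftrightarrow> (i = w \<and> i \<noteq> length ns - 1) \<or> i = Suc w"
  "incident ns (i, j) (Inner i' j') \<longleftrightarrow> i = i' \<and> (j = Suc j' \<or> j = j' \<and> j \<noteq> col_len ns i - 1)"
proof -
  show "incident ns (i, j) Rbot \<longleftrightarrow> j = col_len ns i - 1"
    by (simp add: incident_def north_def south_def west_def east_def)
  show "incident ns (i, j) (Wreg w) \<longleftrightarrow> (i = w \<and> i \<noteq> length ns - 1) \<or> i = Suc w"
    by (cases i) (auto simp: incident_def north_def south_def west_def east_def)
  show "incident ns (i, j) (Inner i' j') \<longleftrightarrow> i = i' \<and> (j = Suc j' \<or> j = j' \<and> j \<noteq> col_len ns i - 1)"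
    by (cases j) (auto simp: incident_def north_def south_def west_def east_def)
qed

lemma bij_region_of: "bij_betw region_of (pcrossings ns) (free_regions ns)"
proof (rule bij_betw_imageI)
  show "inj_on region_of (pcrossings ns)"
    by (auto simp: inj_on_def region_of_def split: if_splits)
  show "region_of ` pcrossings ns = free_regions ns"
  proof (intro equalityI subsetI)
    fix R assume "R \<in> region_of ` pcrossings ns"
    then obtain i j where R: "i < length ns" "j < col_len ns i" "R = region_of (i, j)" by auto
    consider "j > 0" | "j = 0" "i = 0" | "j = 0" "i > 0" by blast
    then have "\<exists>c\<in>pcrossings ns. incident ns c R"
    proof cases
      \<comment> \<open>The partner of \<open>Rbot\<close> is the top crossing
        \<open>(0, 0)\<close>, in general not incident with it; the bottom crossing of the first
        column is.\<close>
      case 2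
      then show ?thesis using R
        by (intro bexI[of _ "(0, col_len ns 0 - 1)"]) (auto simp: region_of_def incident_iff)
    qed (use R in \<open>auto simp: region_of_def incident_iff intro!: bexI[of _ "(i, j)"]\<close>)
    then show "R \<in> free_regions ns" using R by (auto simp: free_regions_def region_of_def)
  next
    fix R assume "R \<in> free_regions ns"
    then obtain i j where R: "i < length ns" "j < col_len ns i" "incident ns (i, j) R" "R \<noteq> U" "R \<noteq> Rtop"
      by (auto simp: free_regions_def)
    show "R \<in> region_of ` pcrossings ns"
    proof (cases R)
      case Rbot
      then show ?thesis using nonempty col_len_pos[of 0]
        by (intro image_eqI[of _ _ "(0, 0)"]) (auto simp: region_of_def)
    next
      case (Inner i' j')
      then show ?thesis using R
        by (intro image_eqI[of _ _ "(i', Suc j')"]) (auto simp: region_of_def incident_iff)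
    next
      case (Wreg w)
      then show ?thesis using R col_len_pos[of "Suc w"]
        by (intro image_eqI[of _ _ "(Suc w, 0)"]) (auto simp: region_of_def incident_iff)
    qed (use R in auto)
  qed
qed

section \<open>The live crossing of each region\<close>

lemma is_live_iff:
  assumes "c \<in> pcrossings ns" "incident ns c R"
  shows "is_live ns c R \<longleftrightarrow> (\<forall>c'\<in>pcrossings ns. incident ns c' R \<longrightarrow> cnum ns c \<le> cnum ns c')"
proof -
  let ?X = "cnum ns ` {c' \<in> pcrossings ns. incident ns c' R}"
  have "finite ?X" "cnum ns c \<in> ?X" using assms by auto
  then have "cnum ns c = Min ?X \<longleftrightarrow> (\<forall>x\<in>?X. cnum ns c \<le> x)"
    by (metis (no_types, lifting) Min_eqI Min_le)
  then show ?thesis by (auto simp: is_live_def)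
qed

text \<open>Every column has its bottom crossing at the lower deck, and the first column is numbered
  before all others.\<close>

lemma is_live_Rbot:
  assumes "i < length ns" "j = col_len ns i - 1"
  shows "is_live ns (i, j) Rbot \<longleftrightarrow> i = 0"
proof -
  have m0: "0 < col_len ns 0" "0 < col_len ns i" using col_len_pos assms nonempty by auto
  have c: "(i, j) \<in> pcrossings ns" "(0, col_len ns 0 - 1) \<in> pcrossings ns"
    using assms m0 nonempty by auto
  show ?thesis
  proof (cases "i = 0")
    case True
    have "cnum ns (i, j) \<le> cnum ns (i', j')"
      if "(i', j') \<in> pcrossings ns" "j' = col_len ns i' - 1" for i' j'
      using cnum_less[of i j i' j'] that c True assms by (cases "i' = 0") auto
    then show ?thesis using True assms c by (subst is_live_iff) (auto simp: incident_iff)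
  next
    case False
    then have "cnum ns (0, col_len ns 0 - 1) < cnum ns (i, j)" using c by (intro cnum_less) auto
    then show ?thesis using False assms c
      by (subst is_live_iff)
         (auto simp: incident_iff not_le intro!: bexI[of _ "(0, col_len ns 0 - 1)"])
  qed
qed

lemma is_live_Inner:
  assumes "i < length ns" "Suc t < col_len ns i" "j = t \<or> j = Suc t"
  shows "is_live ns (i, j) (Inner i t) \<longleftrightarrow> (if i = 0 then j = t else j = Suc t)"
proof -
  have inc: "c \<in> pcrossings ns \<and> incident ns c (Inner i t) \<longleftrightarrow> c = (i, t) \<or> c = (i, Suc t)" for c
    using assms by (cases c) (auto simp: incident_iff)
  have "is_live ns (i, j) (Inner i t) \<longleftrightarrow>
     cnum ns (i, j) \<le> cnum ns (i, t) \<and> cnum ns (i, j) \<le> cnum ns (i, Suc t)"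
  proof (subst is_live_iff)
    show "(i, j) \<in> pcrossings ns" "incident ns (i, j) (Inner i t)" using inc assms by auto
  qed (metis inc)
  then show ?thesis using assms by (auto simp: cnum_eq)
qed

text \<open>Column \<open>w\<close> is numbered before column \<open>Suc w\<close>, so the live
  crossing is the first one of column \<open>w\<close>: its top one for \<open>w = 0\<close> and its
  bottom one otherwise.\<close>

lemma is_live_Wreg:
  assumes "Suc w < length ns" "(i, j) \<in> pcrossings ns" "i = w \<or> i = Suc w"
  shows "is_live ns (i, j) (Wreg w) \<longleftrightarrow> i = w \<and> (if i = 0 then j = 0 else j = col_len ns i - 1)"
proof -
  let ?j0 = "if w = 0 then 0 else col_len ns w - 1"
  have m: "0 < col_len ns w" "0 < col_len ns (Suc w)" using col_len_pos assms by auto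
  have c0: "(w, ?j0) \<in> pcrossings ns" using assms m by auto
  have inc: "incident ns (i', j') (Wreg w) \<longleftrightarrow> i' = w \<or> i' = Suc w" for i' j'
    using assms by (auto simp: incident_iff)
  have min: "cnum ns (w, ?j0) \<le> cnum ns (i', j')"
    if "(i', j') \<in> pcrossings ns" "i' = w \<or> i' = Suc w" for i' j'
  proof (cases "i' = w")
    case True
    then show ?thesis using that assms by (auto simp: cnum_eq)
  next
    case False
    then show ?thesis using that c0 by (intro less_imp_le cnum_less) auto
  qed
  have "is_live ns (i, j) (Wreg w) \<longleftrightarrow> cnum ns (i, j) = cnum ns (w, ?j0)"
  proof -
    have "is_live ns (i, j) (Wreg w) \<longleftrightarrow>
      (\<forall>c'\<in>pcrossings ns. incident ns c' (Wreg w) \<longrightarrow> cnum ns (i, j) \<le> cnum ns c')"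
      using assms by (subst is_live_iff) (auto simp: inc)
    also have "\<dots> \<longleftrightarrow> cnum ns (i, j) \<le> cnum ns (w, ?j0)"
    proof (intro iffI ballI impI)
      fix c' assume "cnum ns (i, j) \<le> cnum ns (w, ?j0)" "c' \<in> pcrossings ns" "incident ns c' (Wreg w)"
      then show "cnum ns (i, j) \<le> cnum ns c'"
        using min[of "fst c'" "snd c'"] inc[of "fst c'" "snd c'"] by (metis order_trans prod.collapse)
    qed (use c0 inc in blast)
    also have "\<dots> \<longleftrightarrow> cnum ns (i, j) = cnum ns (w, ?j0)"
      using min[OF assms(2,3)] by auto
    finally show ?thesis .
  qed
  also have "\<dots> \<longleftrightarrow> (i, j) = (w, ?j0)"
    by (rule inj_on_eq_iff[OF inj_on_cnum assms(2) c0])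
  also have "\<dots> \<longleftrightarrow> i = w \<and> (if i = 0 then j = 0 else j = col_len ns i - 1)"
    by (cases "i = w") simp_all
  finally show ?thesis .
qed

end

section \<open>Elimination\<close>

definition live_weight :: "complex \<Rightarrow> complex" where
  "live_weight a = - (a powi (-3))"

definition loop_value :: "complex \<Rightarrow> complex" where
  "loop_value a = - (a ^ 2) - inverse (a ^ 2)"

text \<open>The total weight of the smoothings of a column that are not all vertical, each loop between
  consecutive horizontal smoothings counted with \<open>loop_value a\<close>; see \<open>cap_weight_Pow\<close>.\<close>
fun cap_weight :: "complex \<Rightarrow> nat \<Rightarrow> complex" where
  "cap_weight a 0 = 0"
| "cap_weight a (Suc m) = live_weight a * cap_weight a m + inverse a * a ^ m"

lemma loop_value_inverse [simp]: "loop_value (inverse a) = loop_value a"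
  by (simp add: loop_value_def power_inverse)

text \<open>This is the curl relation of the bracket: a curl contributes \<open>a\<close> for one
  smoothing and \<open>inverse a\<close> times a loop for the other.\<close>

lemma live_weight_eq: "a \<noteq> 0 \<Longrightarrow> live_weight a = a + inverse a * loop_value a"
  by (simp add: live_weight_def loop_value_def power_int_minus field_simps power2_eq_square power3_eq_cube)

text \<open>With its top ends joined and its bottom ends joined, a column is a chain of curls.
  Smoothed vertically it leaves one loop; ending in a cup and a cap it leaves two.\<close>

lemma live_weight_power:
  "a \<noteq> 0 \<Longrightarrow> live_weight a ^ m = a ^ m + loop_value a * cap_weight a m"
proof (induction m)
  case (Suc m)
  have "live_weight a ^ Suc m = live_weight a * a ^ m + loop_value a * (live_weight a * cap_weight a m)"
    using Suc by (simp add: algebra_simps)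
  also have "live_weight a * a ^ m = a ^ Suc m + loop_value a * (inverse a * a ^ m)"
    using Suc.prems by (subst live_weight_eq) (simp_all add: algebra_simps)
  finally show ?case by (simp add: algebra_simps)
qed simp

text \<open>Unrolling the recursion of \<open>cap_weight\<close> gives this sum. The merged rows
  produce it in this order for columns numbered upwards and in the reverse order for the first
  column.\<close>

lemma cap_weight_sum:
  "inverse a * (\<Sum>t<m. a ^ t * live_weight a ^ (m - 1 - t)) = cap_weight a m"
proof (induction m)
  case (Suc m)
  have "(\<Sum>t<Suc m. a ^ t * live_weight a ^ (Suc m - 1 - t)) =
    live_weight a * (\<Sum>t<m. a ^ t * live_weight a ^ (m - 1 - t)) + a ^ m"
  proof -
    have *: "a ^ t * live_weight a ^ (Suc m - 1 - t) = live_weight a * (a ^ t * live_weight a ^ (m - 1 - t))"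
      if "t < m" for t
    proof -
      have "m - t = Suc (m - 1 - t)" using that by simp
      then show ?thesis by simp
    qed
    show ?thesis unfolding sum.lessThan_Suc sum_distrib_left
      by (rule arg_cong2[where f = "(+)"], rule sum.cong) (simp_all only: lessThan_iff *, simp)
  qed
  then show ?case using Suc by (simp add: algebra_simps)
qed simp

lemma cap_weight_sum_rev:
  "inverse a * (\<Sum>t<m. live_weight a ^ t * a ^ (m - 1 - t)) = cap_weight a m"
proof -
  have "(\<Sum>t<m. live_weight a ^ t * a ^ (m - 1 - t)) = (\<Sum>t<m. a ^ t * live_weight a ^ (m - 1 - t))"
    by (subst sum.nat_diff_reindex[symmetric]) (auto intro!: sum.cong simp: mult.commute)
  then show ?thesis using cap_weight_sum by simp
qed

context pretzel
begin

text \<open>Barred letters are the plain letters at \<open>inverse A\<close>, so one formula in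
  \<open>tait_var A i\<close> covers both Tait signs.\<close>

definition tait_var :: "complex \<Rightarrow> nat \<Rightarrow> complex" where
  "tait_var A i = (if ns ! i > 0 then A else inverse A)"

lemma tait_var_nonzero [simp]: "A \<noteq> 0 \<Longrightarrow> tait_var A i \<noteq> 0"
  by (simp add: tait_var_def)

lemma loop_value_tait_var [simp]: "loop_value (tait_var A i) = loop_value A"
  by (simp add: tait_var_def)

definition base_sign :: "crossing \<Rightarrow> region \<Rightarrow> complex" where
  "base_sign c R = (if R = north ns c \<or> R = west ns c then -1 else 1)"

definition base_entry :: "complex \<Rightarrow> crossing \<Rightarrow> region \<Rightarrow> complex" where
  "base_entry A c R = (if incident ns c R then base_sign c R * alpha_val ns c R A else 0)"

lemma alpha_val_eq:
  "alpha_val ns (i, j) R A =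
     (if is_black R then (if is_live ns (i, j) R then live_weight (tait_var A i) else tait_var A i)
      else (if is_live ns (i, j) R then - (tait_var A i ^ 3) else inverse (tait_var A i)))"
  by (simp add: alpha_val_def tait_var_def tait_pos_def live_weight_def Let_def)

text \<open>The first column is numbered downwards and all others upwards, so a region inside the first column
  is live at its upper crossing, and inside any other column at its lower crossing.\<close>
definition upper_weight :: "complex \<Rightarrow> nat \<Rightarrow> complex" where
  "upper_weight A i = (if i = 0 then tait_var A i else live_weight (tait_var A i))"

definition lower_weight :: "complex \<Rightarrow> nat \<Rightarrow> complex" where
  "lower_weight A i = (if i = 0 then live_weight (tait_var A i) else tait_var A i)"

section \<open>Entries of the matrix with the reference signs\<close>

lemma base_entry_Inner_north:
  assumes "i < length ns" "0 < j" "j < col_len ns i"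
  shows "base_entry A (i, j) (Inner i (j - 1)) = - upper_weight A i"
  using assms is_live_Inner[of i "j - 1" j]
  by (auto simp: base_entry_def incident_iff base_sign_def north_def alpha_val_eq upper_weight_def)

lemma base_entry_Inner_south:
  assumes "i < length ns" "Suc j < col_len ns i"
  shows "base_entry A (i, j) (Inner i j) = lower_weight A i"
  using assms is_live_Inner[of i j j]
  by (auto simp: base_entry_def incident_iff base_sign_def north_def west_def alpha_val_eq lower_weight_def)

lemma base_entry_Inner_other:
  assumes "x \<noteq> (i, j)" "x \<noteq> (i, Suc j)"
  shows "base_entry A x (Inner i j) = 0"
  using assms by (cases x) (auto simp: base_entry_def incident_iff)

lemma base_entry_Rbot:
  assumes "(i, j) \<in> pcrossings ns"
  shows "base_entry A (i, j) Rbot = (if j = col_len ns i - 1 then lower_weight A i else 0)"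
  using assms is_live_Rbot[of i j]
  by (auto simp: base_entry_def incident_iff base_sign_def north_def west_def alpha_val_eq lower_weight_def)

text \<open>For \<open>i = w\<close> the entry is written as the dead value plus a correction at the
  live crossing, so that summing over the column separates \<open>cap\<close> from a single extra
  term.\<close>

lemma base_entry_Wreg:
  assumes "(i, j) \<in> pcrossings ns" "Suc w < length ns"
  shows "base_entry A (i, j) (Wreg w) =
    (if i = w then inverse (tait_var A i) + (if j = (if i = 0 then 0 else col_len ns i - 1)
        then - (tait_var A i ^ 3) - inverse (tait_var A i) else 0)
     else if i = Suc w then - inverse (tait_var A i) else 0)"
  using assms is_live_Wreg[of w i j]
  by (auto simp: base_entry_def incident_iff base_sign_def north_def west_def alpha_val_eq)

text \<open>\<open>cap A i\<close> and \<open>bars A i\<close> are the weights Y and X of column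
  \<open>i\<close> in the outline at the beginning.\<close>

definition cap :: "complex \<Rightarrow> nat \<Rightarrow> complex" where
  "cap A i = cap_weight (tait_var A i) (col_len ns i)"

definition bars :: "complex \<Rightarrow> nat \<Rightarrow> complex" where
  "bars A i = tait_var A i ^ col_len ns i"

text \<open>Up to sign, the row that \<open>leibniz_det_chain\<close> leaves at the top crossing of
  column \<open>i\<close> once the inner regions of that column are eliminated.\<close>

definition merged_row :: "complex \<Rightarrow> nat \<Rightarrow> region \<Rightarrow> complex" where
  "merged_row A i R = (\<Sum>t<col_len ns i.
     lower_weight A i ^ t * upper_weight A i ^ (col_len ns i - 1 - t) * base_entry A (i, t) R)"

text \<open>Only the bottom crossing meets \<open>Rbot\<close>, which leaves
  \<open>lower_weight A i ^ col_len ns i\<close>. This is \<open>bars A i\<close> for the later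
  columns; for the first one it is a power of \<open>live_weight\<close>, expanded by
  \<open>live_weight_power\<close>.\<close>

lemma merged_row_Rbot:
  assumes "A \<noteq> 0" "i < length ns"
  shows "merged_row A i Rbot = bars A i + (if i = 0 then loop_value A * cap A i else 0)"
proof -
  obtain m where m: "col_len ns i = Suc m" using col_len_pos[OF assms(2)] by (cases "col_len ns i") auto
  have "merged_row A i Rbot = (\<Sum>t<Suc m. if t = m then lower_weight A i ^ Suc m else 0)"
    unfolding merged_row_def m
    by (intro sum.cong refl) (use assms in \<open>auto simp: base_entry_Rbot m\<close>)
  also have "\<dots> = lower_weight A i ^ Suc m" by simp
  also have "\<dots> = bars A i + (if i = 0 then loop_value A * cap A i else 0)"
    unfolding m[symmetric] using live_weight_power[of "tait_var A i" "col_len ns i"] assms(1)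
    by (cases "i = 0") (simp_all add: lower_weight_def bars_def cap_def)
  finally show ?thesis .
qed

lemma cap_sum:
  "(\<Sum>t<col_len ns i. lower_weight A i ^ t * upper_weight A i ^ (col_len ns i - 1 - t) *
     inverse (tait_var A i)) = cap A i"
  unfolding sum_distrib_right[symmetric] lower_weight_def upper_weight_def cap_def
  using cap_weight_sum[of "tait_var A i" "col_len ns i"] cap_weight_sum_rev[of "tait_var A i" "col_len ns i"]
  by (cases "i = 0") (simp_all add: mult.commute)

lemma merged_row_west:
  assumes "Suc i < length ns"
  shows "merged_row A (Suc i) (Wreg i) = - cap A (Suc i)"
proof -
  have "merged_row A (Suc i) (Wreg i) = (\<Sum>t<col_len ns (Suc i).
      - (lower_weight A (Suc i) ^ t * upper_weight A (Suc i) ^ (col_len ns (Suc i) - 1 - t) *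
      inverse (tait_var A (Suc i))))"
    unfolding merged_row_def by (intro sum.cong refl) (use assms in \<open>simp add: base_entry_Wreg\<close>)
  then show ?thesis by (simp only: sum_negf cap_sum)
qed

lemma merged_row_east:
  assumes "A \<noteq> 0" "Suc i < length ns"
  shows "merged_row A i (Wreg i) = cap A i + loop_value A * bars A i"
proof -
  define a where "a = tait_var A i"
  obtain m where m: "col_len ns i = Suc m" using col_len_pos[of i] assms by (cases "col_len ns i") auto
  define t0 where "t0 = (if i = 0 then 0 else m)"
  let ?f = "\<lambda>t. lower_weight A i ^ t * upper_weight A i ^ (col_len ns i - 1 - t)"
  have "merged_row A i (Wreg i) = (\<Sum>t<col_len ns i.
      ?f t * inverse a + (if t = t0 then ?f t * (- (a ^ 3) - inverse a) else 0))"
    unfolding merged_row_def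
    by (intro sum.cong refl) (use assms in \<open>simp add: base_entry_Wreg a_def t0_def m ring_distribs\<close>)
  also have "\<dots> = cap A i + ?f t0 * (- (a ^ 3) - inverse a)"
    unfolding sum.distrib a_def cap_sum by (simp add: t0_def m)
  \<comment> \<open>\<open>t0\<close> is the end of the column where the numbering starts, and there
    every factor is the dead weight: all are \<open>upper_weight\<close> in the first column and
    \<open>lower_weight\<close> in the others.\<close>
  also have "?f t0 = a ^ m"
    by (simp add: t0_def m lower_weight_def upper_weight_def a_def)
  also have "a ^ m * (- (a ^ 3) - inverse a) = loop_value A * bars A i"
  proof -
    have "a \<noteq> 0" using assms by (simp add: a_def)
    then have "- (a ^ 3) - inverse a = loop_value a * a"
      by (simp add: loop_value_def field_simps power2_eq_square power3_eq_cube)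
    moreover have "loop_value a = loop_value A" by (simp add: a_def)
    moreover have "bars A i = a ^ m * a" by (simp add: bars_def m a_def)
    ultimately show ?thesis by simp
  qed
  finally show ?thesis .
qed

lemma merged_row_other:
  assumes "i < length ns" "Suc w < length ns" "i \<noteq> w" "i \<noteq> Suc w"
  shows "merged_row A i (Wreg w) = 0"
  unfolding merged_row_def
  by (intro sum.neutral ballI) (use assms in \<open>simp add: base_entry_Wreg\<close>)

text \<open>The inner regions of column \<open>n\<close> meet only its own crossings, so the rows
  merged earlier vanish there and \<open>leibniz_det_chain\<close> applies along the column from the
  top down.\<close>

lemma leibniz_det_merge_columns:
  assumes "n \<le> length ns"
  shows "leibniz_det (pcrossings ns) (\<lambda>c y. base_entry A c (region_of y)) =
    leibniz_det (pcrossings ns - {(i, j). i < n \<and> 0 < j})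
      (\<lambda>c y. if fst c < n \<and> snd c = 0
        then (-1) ^ (col_len ns (fst c) - 1) * merged_row A (fst c) (region_of y)
        else base_entry A c (region_of y))"
  using assms
proof (induction n)
  case 0
  then show ?case by simp
next
  case (Suc n)
  let ?F = "\<lambda>n c y. if fst c < n \<and> snd c = 0
        then (-1) ^ (col_len ns (fst c) - 1) * merged_row A (fst c) (region_of y)
        else base_entry A c (region_of y)"
  let ?S = "\<lambda>n. pcrossings ns - {(i, j). i < n \<and> 0 < j}"
  obtain m where m: "col_len ns n = Suc m" using col_len_pos[of n] Suc.prems by (cases "col_len ns n") auto
  have n: "n < length ns" using Suc.prems by simp
  have row: "?F n (n, t) y = base_entry A (n, t) (region_of y)" for t y by simp
  have "leibniz_det (?S n) (?F n) = leibniz_det (?S n - Pair n ` {1..m})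
    ((?F n)((n, 0) := \<lambda>y. (-1) ^ m * (\<Sum>t\<le>m. (\<Prod>j<t. lower_weight A n) *
       (\<Prod>j\<in>{t<..m}. upper_weight A n) * ?F n (n, t) y)))"
  proof (rule leibniz_det_chain)
    show "inj_on (Pair n) {..m}" by (simp add: inj_on_def)
    show "Pair n ` {..m} \<subseteq> ?S n" using n m by auto
    show "?F n (n, j) (n, j) = - upper_weight A n" if "j \<in> {1..m}" for j
      using that n m base_entry_Inner_north[of n j] by (simp add: region_of_def)
    show "?F n (n, j) (n, Suc j) = lower_weight A n" if "j < m" for j
      using that n m base_entry_Inner_south[of n j] by (simp add: region_of_def)
    show "?F n x (n, j) = 0" if "j \<in> {1..m}" "x \<in> ?S n" "x \<noteq> (n, j - 1)" "x \<noteq> (n, j)" for j x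
    proof -
      have "region_of (n, j) = Inner n (j - 1)" using that by (simp add: region_of_def)
      moreover have "base_entry A x (Inner n (j - 1)) = 0"
        if "x \<noteq> (n, j - 1)" "x \<noteq> (n, j)" for x
        using that \<open>j \<in> {1..m}\<close> by (intro base_entry_Inner_other) auto
      moreover have "merged_row A i (Inner n (j - 1)) = 0" if "i < n" for i
        unfolding merged_row_def using that by (intro sum.neutral) (auto intro!: base_entry_Inner_other)
      ultimately show ?thesis using that by simp
    qed
  qed simp
  also have "?S n - Pair n ` {1..m} = ?S (Suc n)"
    using m by (auto simp: image_iff less_Suc_eq)
  also have "(?F n)((n, 0) := \<lambda>y. (-1) ^ m * (\<Sum>t\<le>m. (\<Prod>j<t. lower_weight A n) *
       (\<Prod>j\<in>{t<..m}. upper_weight A n) * ?F n (n, t) y)) = ?F (Suc n)"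
  proof (intro ext)
    fix c y
    show "((?F n)((n, 0) := \<lambda>y. (-1) ^ m * (\<Sum>t\<le>m. (\<Prod>j<t. lower_weight A n) *
       (\<Prod>j\<in>{t<..m}. upper_weight A n) * ?F n (n, t) y))) c y = ?F (Suc n) c y"
    proof (cases "c = (n, 0)")
      case True
      then show ?thesis by (simp add: merged_row_def m lessThan_Suc_atMost)
    next
      case False
      then show ?thesis by (cases c) (auto simp: less_Suc_eq)
    qed
  qed
  finally show ?case using Suc by simp
qed

text \<open>After the merging one row per column of the diagram is left, and
  \<open>Wreg (j - 1)\<close> meets only rows \<open>j - 1\<close> and \<open>j\<close>. A second
  chain through the top crossings absorbs all rows into the first and leaves the single entry at
  \<open>Rbot\<close>.\<close>

lemma leibniz_det_base_entry:
  assumes A: "A \<noteq> 0"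
  shows "leibniz_det (pcrossings ns) (\<lambda>c y. base_entry A c (region_of y)) =
    (\<Prod>i<length ns. (-1) ^ (col_len ns i - 1)) * (-1) ^ (length ns - 1) *
    (loop_value A * (\<Prod>i<length ns. cap A i) +
     (\<Sum>t<length ns. (\<Prod>j<t. cap A j + loop_value A * bars A j) * bars A t *
        (\<Prod>j\<in>{t<..<length ns}. cap A j)))"
proof -
  let ?d = "loop_value A"
  let ?e = "\<lambda>i::nat. (i, 0::nat)"
  obtain k where k: "length ns = Suc k" using nonempty by (cases ns) auto
  define G :: "crossing \<Rightarrow> crossing \<Rightarrow> complex" where "G = (\<lambda>c y. merged_row A (fst c) (region_of y))"
  define sg :: "crossing \<Rightarrow> complex" where "sg = (\<lambda>c. (-1) ^ (col_len ns (fst c) - 1))"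
  have S: "pcrossings ns - {(i, j). i < length ns \<and> 0 < j} = ?e ` {..k}"
    using col_len_pos by (auto simp: k less_Suc_eq_le)
  have inj: "inj_on ?e X" for X by (simp add: inj_on_def)
  have "leibniz_det (pcrossings ns) (\<lambda>c y. base_entry A c (region_of y)) =
      leibniz_det (?e ` {..k}) (\<lambda>c y. sg c * 1 * G c y)"
    unfolding leibniz_det_merge_columns[OF order_refl] S
    by (rule leibniz_det_cong) (auto simp: k less_Suc_eq_le sg_def G_def)
  also have "\<dots> = (\<Prod>c\<in>?e ` {..k}. sg c * 1) * leibniz_det (?e ` {..k}) G"
    by (rule leibniz_det_scale)
  also have "(\<Prod>c\<in>?e ` {..k}. sg c * 1) = (\<Prod>i<length ns. (-1) ^ (col_len ns i - 1))"
    by (simp add: prod.reindex inj sg_def k lessThan_Suc_atMost)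
  also have "leibniz_det (?e ` {..k}) G = leibniz_det (?e ` {..k} - ?e ` {1..k})
     (G(?e 0 := \<lambda>y. (-1) ^ k * (\<Sum>t\<le>k. (\<Prod>j<t. cap A j + ?d * bars A j) *
        (\<Prod>j\<in>{t<..k}. cap A j) * G (?e t) y)))"
  proof (rule leibniz_det_chain)
    show "G (j, 0) (j, 0) = - cap A j" if "j \<in> {1..k}" for j
      using that merged_row_west[of "j - 1" A] by (simp add: G_def region_of_def k)
    show "G (j, 0) (Suc j, 0) = cap A j + ?d * bars A j" if "j < k" for j
      using that merged_row_east[OF A, of j] by (simp add: G_def region_of_def k)
    show "G x (j, 0) = 0" if j: "j \<in> {1..k}" and x: "x \<in> ?e ` {..k}" "x \<noteq> (j - 1, 0)" "x \<noteq> (j, 0)" for j x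
    proof -
      obtain i w where "x = (i, 0)" "j = Suc w" "i \<le> k" "w < k"
        using j x(1) by (cases j) auto
      then show ?thesis
        using x(2,3) merged_row_other[of i w A] by (simp add: G_def region_of_def k)
    qed
  qed (auto simp: inj_on_def)
  also have "?e ` {..k} - ?e ` {1..k} = {?e 0}" by auto
  also have "leibniz_det {?e 0} (G(?e 0 := \<lambda>y. (-1) ^ k * (\<Sum>t\<le>k. (\<Prod>j<t. cap A j + ?d * bars A j) *
        (\<Prod>j\<in>{t<..k}. cap A j) * G (?e t) y))) =
     (-1) ^ k * (\<Sum>t\<le>k. (\<Prod>j<t. cap A j + ?d * bars A j) *
        (\<Prod>j\<in>{t<..k}. cap A j) * G (?e t) (0, 0))"
    by simp
  \<comment> \<open>The extra summand \<open>?d * cap A 0\<close> of the first row completes the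
    product over j > 0 to the product of all caps.\<close>
  also have "(\<Sum>t\<le>k. (\<Prod>j<t. cap A j + ?d * bars A j) *
        (\<Prod>j\<in>{t<..k}. cap A j) * G (?e t) (0, 0)) =
     (\<Sum>t\<le>k. (\<Prod>j<t. cap A j + ?d * bars A j) * bars A t * (\<Prod>j\<in>{t<..k}. cap A j) +
        (if t = 0 then ?d * (\<Prod>i\<le>k. cap A i) else 0))"
  proof (rule sum.cong[OF refl])
    fix t assume "t \<in> {..k}"
    then have "G (?e t) (0, 0) = bars A t + (if t = 0 then ?d * cap A t else 0)"
      using merged_row_Rbot[OF A, of t] by (simp add: G_def region_of_def k)
    moreover have "(\<Prod>i\<le>k. cap A i) = cap A 0 * (\<Prod>j\<in>{0<..k}. cap A j)"
    proof -
      have "{..k} = insert 0 {0<..k}" by auto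
      then show ?thesis by simp
    qed
    ultimately show "(\<Prod>j<t. cap A j + ?d * bars A j) * (\<Prod>j\<in>{t<..k}. cap A j) * G (?e t) (0, 0) =
      (\<Prod>j<t. cap A j + ?d * bars A j) * bars A t * (\<Prod>j\<in>{t<..k}. cap A j) +
        (if t = 0 then ?d * (\<Prod>i\<le>k. cap A i) else 0)"
      by (simp add: algebra_simps)
  qed
  also have "\<dots> = ?d * (\<Prod>i\<le>k. cap A i) +
      (\<Sum>t\<le>k. (\<Prod>j<t. cap A j + ?d * bars A j) * bars A t * (\<Prod>j\<in>{t<..k}. cap A j))"
    by (simp add: sum.distrib add.commute)
  finally have "leibniz_det (pcrossings ns) (\<lambda>c y. base_entry A c (region_of y)) =
    (\<Prod>i<length ns. (-1) ^ (col_len ns i - 1)) * ((-1) ^ k * (?d * (\<Prod>i\<le>k. cap A i) +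
      (\<Sum>t\<le>k. (\<Prod>j<t. cap A j + ?d * bars A j) * bars A t * (\<Prod>j\<in>{t<..k}. cap A j))))" .
  moreover have "{t<..<length ns} = {t<..k}" for t by (auto simp: k)
  ultimately show ?thesis unfolding k lessThan_Suc_atMost by (simp add: mult.assoc)
qed

end

section \<open>The signs \<kappa>\<close>

lemma prod_signs: "(\<And>x. x \<in> S \<Longrightarrow> f x \<in> {1, -1 :: 'a::comm_ring_1}) \<Longrightarrow> prod f S \<in> {1, -1}"
  by (induction S rule: infinite_finite_induct) fastforce+

context pretzel
begin

text \<open>Across an arc the sign \<open>g\<close> changes by a factor determined by the orientation; the corner signs
  (+ at NW and SE, - at NE and SW) make the factors read off at the two ends of an arc agree.\<close>
lemma region_signs_exist:
  assumes out: "is_orientation ns out"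
  defines "s \<equiv> \<lambda>e. if out e then -1 else (1::complex)"
  shows "\<exists>g. (\<forall>R. g R \<in> {1, -1}) \<and> (\<forall>c\<in>pcrossings ns.
    g (north ns c) * g (west ns c) = s (c, NW) \<and> g (north ns c) * g (east ns c) = - s (c, NE) \<and>
    g (south ns c) * g (west ns c) = - s (c, SW) \<and> g (south ns c) * g (east ns c) = s (c, SE))"
proof -
  let ?k = "length ns"
  let ?m = "col_len ns"
  have s: "s e \<in> {1, -1}" for e by (simp add: s_def)
  have ss [simp]: "s e * s e = 1" "s e * (s e * z) = z" for e z by (simp_all add: s_def)
  have cross: "s (c, SE) = - s (c, NW)" "s (c, SW) = - s (c, NE)" if "c \<in> pcrossings ns" for c
    using out that by (auto simp: is_orientation_def s_def)
  have arc: "s q = - s p" if "(p, q) \<in> parcs ns" for p q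
    using out that by (auto simp: is_orientation_def s_def)
  have left: "s ((i, Suc j), NW) = - s ((i, j), SW)" if "i < ?k" "Suc j < ?m i" for i j
    by (rule arc) (use that in \<open>auto simp: parcs_def\<close>)
  have right: "s ((i, Suc j), NE) = - s ((i, j), SE)" if "i < ?k" "Suc j < ?m i" for i j
    by (rule arc) (use that in \<open>auto simp: parcs_def\<close>)
  have top: "s ((Suc i, 0), NW) = - s ((i, 0), NE)" if "Suc i < ?k" for i
    by (rule arc) (use that in \<open>auto simp: parcs_def\<close>)
  have bot: "s ((Suc i, ?m (Suc i) - 1), SW) = - s ((i, ?m i - 1), SE)" if "Suc i < ?k" for i
    by (rule arc) (use that in \<open>auto simp: parcs_def\<close>)
  have outer: "s ((?k - 1, 0), NE) = - s ((0, 0), NW)"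
    by (rule arc) (auto simp: parcs_def)
  \<comment> \<open>Normalised by the value 1 at \<open>U\<close>. The other values are forced by
    single corners: \<open>Rtop\<close> by the NW corner of the first column, \<open>Wreg i\<close>
    by the NE corner at the top of column \<open>i\<close>, \<open>Rbot\<close> and the inner
    regions by SW corners.\<close>
  define gt where "gt = s ((0, 0), NW)"
  define gw where "gw = (\<lambda>i. - (gt * s ((i, 0), NE)))"
  define gl where "gl = (\<lambda>i. if i = 0 then 1 else gw (i - 1))"
  define g where "g = (\<lambda>R. case R of U \<Rightarrow> 1 | Rtop \<Rightarrow> gt | Rbot \<Rightarrow> - s ((0, ?m 0 - 1), SW)
     | Wreg i \<Rightarrow> gw i | Inner i j \<Rightarrow> - (gl i * s ((i, j), SW)))"
  have sgn: "g R \<in> {1, -1}" for R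
    by (cases R) (auto simp: g_def gt_def gw_def gl_def s_def)
  have gg [simp]: "g R * g R = 1" "g R * (g R * z) = z" for R z using sgn[of R] by auto
  have gl_west: "g (west ns (i, j)) = gl i" for i j
    by (simp add: west_def g_def gl_def)
  \<comment> \<open>For the last column the east region is \<open>U\<close>, and the upper outer arc
    makes its value 1 agree with this formula.\<close>
  have ge: "g (east ns (i, j)) = - (gt * s ((i, 0), NE))" if "i < ?k" for i j
  proof (cases "i = ?k - 1")
    case True
    then have "g (east ns (i, j)) = 1" by (simp add: east_def g_def)
    moreover have "gt * s ((i, 0), NE) = -1" using outer True by (simp add: gt_def)
    ultimately show ?thesis by simp
  next
    case False
    then show ?thesis by (simp add: east_def g_def gw_def)
  qed
  have gw: "g (west ns (i, j)) = gt * s ((i, 0), NW)" if "i < ?k" for i j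
    using that top[of "i - 1"] unfolding gl_west by (cases i) (simp_all add: gl_def gw_def gt_def)
  \<comment> \<open>The fourth corner relation is the product of the other three, since opposite
    ends of a strand have opposite \<open>s\<close>.\<close>
  have lower: "g (north ns c) * g (west ns c) = s (c, NW) \<Longrightarrow> g (north ns c) * g (east ns c) = - s (c, NE) \<Longrightarrow>
     g (south ns c) * g (west ns c) = - s (c, SW) \<Longrightarrow> c \<in> pcrossings ns \<Longrightarrow>
     g (south ns c) * g (east ns c) = s (c, SE)" for c
    using cross[of c] sgn[of "north ns c"] sgn[of "south ns c"] sgn[of "west ns c"] sgn[of "east ns c"]
      s[of "(c, NW)"] s[of "(c, NE)"]
    by auto
  have upper: "g (north ns (i, j)) * g (west ns (i, j)) = s ((i, j), NW) \<and>
     g (north ns (i, j)) * g (east ns (i, j)) = - s ((i, j), NE)" if "i < ?k" "j < ?m i" for i j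
    using that(2)
  proof (induction j)
    case 0
    have "gt * gt = 1" by (simp add: gt_def)
    then show ?case using gw[OF that(1), of 0] ge[OF that(1), of 0]
      by (simp add: north_def g_def mult.assoc[symmetric])
  next
    case (Suc j)
    then have IH: "g (north ns (i, j)) * g (west ns (i, j)) = s ((i, j), NW)"
      "g (north ns (i, j)) * g (east ns (i, j)) = - s ((i, j), NE)" by auto
    have eq: "north ns (i, Suc j) = south ns (i, j)" "west ns (i, Suc j) = west ns (i, j)"
      "east ns (i, Suc j) = east ns (i, j)"
      using Suc by (auto simp: north_def south_def west_def east_def)
    have "j \<noteq> col_len ns i - 1" using Suc.prems by simp
    then have "g (south ns (i, j)) = - (gl i * s ((i, j), SW))"
      by (simp add: south_def g_def)
    then have 1: "g (south ns (i, j)) * g (west ns (i, j)) = - s ((i, j), SW)"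
      using gg(2)[of "west ns (i, j)"] by (simp add: gl_west mult.commute mult.left_commute)
    have 2: "g (south ns (i, j)) * g (east ns (i, j)) = s ((i, j), SE)"
      by (rule lower[OF IH 1]) (use that(1) Suc.prems in auto)
    show ?case unfolding eq using 1 2 left[of i j] right[of i j] that(1) Suc.prems by simp
  qed
  have sw_inner: "g (south ns (i, j)) * g (west ns (i, j)) = - s ((i, j), SW)"
    if "i < ?k" "Suc j < ?m i" for i j
  proof -
    have "north ns (i, Suc j) = south ns (i, j)" "west ns (i, Suc j) = west ns (i, j)"
      using that by (auto simp: north_def south_def west_def)
    then show ?thesis using upper[of i "Suc j"] left[of i j] that by simp
  qed
  \<comment> \<open>The value at \<open>Rbot\<close> was read off in the first column; the bottom
    short arcs carry the relation from each column to the next.\<close>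
  have sw_bot: "g Rbot * gl i = - s ((i, ?m i - 1), SW)" if "i < ?k" for i
    using that
  proof (induction i)
    case 0
    then show ?case by (simp add: g_def gl_def)
  next
    case (Suc i)
    let ?c = "(i, ?m i - 1)"
    have mi: "?m i - 1 < ?m i" using col_len_pos[of i] Suc.prems by simp
    have c: "?c \<in> pcrossings ns" using Suc.prems mi by simp
    have S: "south ns ?c = Rbot" by (simp add: south_def)
    have E: "g (east ns ?c) = gl (Suc i)" using Suc.prems by (simp add: east_def g_def gl_def)
    have "g (south ns ?c) * g (west ns ?c) = - s (?c, SW)"
      unfolding S gl_west using Suc by simp
    with upper[of i "?m i - 1"] c have "g (south ns ?c) * g (east ns ?c) = s (?c, SE)"
      by (intro lower) auto
    then show ?case unfolding S E using bot[OF Suc.prems] by simp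
  qed
  have "g (south ns (i, j)) * g (west ns (i, j)) = - s ((i, j), SW)" if "i < ?k" "j < ?m i" for i j
  proof (cases "Suc j < ?m i")
    case True
    then show ?thesis using sw_inner that by blast
  next
    case False
    then have "j = ?m i - 1" using that by simp
    then have "south ns (i, j) = Rbot" by (simp add: south_def)
    then show ?thesis unfolding gl_west using sw_bot[OF that(1)] \<open>j = ?m i - 1\<close> by simp
  qed
  then have "\<forall>c\<in>pcrossings ns.
    g (north ns c) * g (west ns c) = s (c, NW) \<and> g (north ns c) * g (east ns c) = - s (c, NE) \<and>
    g (south ns c) * g (west ns c) = - s (c, SW) \<and> g (south ns c) * g (east ns c) = s (c, SE)"
    using upper lower by auto
  then show ?thesis using sgn by blast
qed

text \<open>Around a crossing the quotient of \<open>kappa\<close> and \<open>base_sign\<close>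
  changes from a region to its neighbour exactly as \<open>g\<close> does, so after division by
  \<open>g\<close> it depends on the crossing only.\<close>

lemma kappa_gauge:
  assumes out: "is_orientation ns out"
  shows "\<exists>f g. (\<forall>c. f c \<in> {1, -1}) \<and> (\<forall>R. g R \<in> {1, -1}) \<and>
    (\<forall>c\<in>pcrossings ns. \<forall>R\<in>free_regions ns. incident ns c R \<longrightarrow>
       kappa ns out c R = f c * g R * base_sign c R)"
proof -
  let ?s = "\<lambda>e. if out e then -1 else (1::complex)"
  obtain g where sgn: "\<And>R. g R \<in> {1, -1}" and g: "\<And>c. c \<in> pcrossings ns \<Longrightarrow>
    g (north ns c) * g (west ns c) = ?s (c, NW) \<and> g (north ns c) * g (east ns c) = - ?s (c, NE) \<and>
    g (south ns c) * g (west ns c) = - ?s (c, SW) \<and> g (south ns c) * g (east ns c) = ?s (c, SE)"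
    using region_signs_exist[OF out] by blast
  \<comment> \<open>\<open>f c\<close> solves the identity at the north region, where
    \<open>base_sign\<close> is -1 and \<open>kappa\<close> is the conditional written here.\<close>
  define f where "f = (\<lambda>c. - ((if out (c, NW) \<and> out (c, NE) then -1 else 1) * g (north ns c)))"
  have "kappa ns out c R = f c * g R * base_sign c R"
    if c: "c \<in> pcrossings ns" and R: "R \<in> free_regions ns" "incident ns c R" for c R
  proof -
    have cross: "out (c, SE) = (\<not> out (c, NW))" "out (c, SW) = (\<not> out (c, NE))"
      using out c by (auto simp: is_orientation_def)
    have RU: "R \<noteq> U" "R \<noteq> Rtop" using R by (auto simp: free_regions_def)
    \<comment> \<open>In a one-column diagram west and east are both \<open>U\<close>; hence the
      restricted form for this pair.\<close>
    have dist: "north ns c \<noteq> south ns c" "north ns c \<noteq> west ns c" "north ns c \<noteq> east ns c"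
      "south ns c \<noteq> west ns c" "south ns c \<noteq> east ns c"
      "R = west ns c \<Longrightarrow> R \<noteq> east ns c"
      using RU by (auto simp: north_def south_def west_def east_def split: if_splits)
    note signs = sgn[of "north ns c"] sgn[of "south ns c"] sgn[of "west ns c"] sgn[of "east ns c"]
    consider "R = north ns c" | "R = south ns c" | "R = west ns c" | "R = east ns c"
      using R(2) by (auto simp: incident_def)
    then show ?thesis
    proof cases
      case 1
      then show ?thesis using g[OF c] signs dist cross
        by (auto simp: kappa_def out_region_def f_def base_sign_def split: if_splits)
    next
      case 2
      then show ?thesis using g[OF c] signs dist cross
        by (auto simp: kappa_def out_region_def f_def base_sign_def split: if_splits)
    next
      case 3
      then show ?thesis using g[OF c] signs dist cross
        by (auto simp: kappa_def out_region_def f_def base_sign_def split: if_splits)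
    next
      case 4
      then show ?thesis using g[OF c] signs dist cross
        by (auto simp: kappa_def out_region_def f_def base_sign_def split: if_splits)
    qed
  qed
  moreover have "f c \<in> {1, -1}" for c using sgn[of "north ns c"] by (auto simp: f_def)
  ultimately show ?thesis using sgn by blast
qed

lemma prod_w_val:
  assumes "A \<noteq> 0"
  shows "(\<Prod>c\<in>pcrossings ns. w_val ns out c A) = (- (A ^ 3)) powi (- pwrithe ns out)"
proof -
  let ?b = "- (A ^ 3)"
  have b: "?b \<noteq> 0" using assms by simp
  have w: "w_val ns out c A = ?b powi (- (if writhe_pos ns out c then 1 else -1))" for c
    using assms by (simp add: w_val_def power_int_minus)
  have "(\<Prod>c\<in>S. ?b powi (- f c)) = ?b powi (- sum f S)" if "finite S" for f :: "crossing \<Rightarrow> int" and S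
    using that b by (induction S) (auto simp: power_int_diff power_int_minus field_simps)
  from this[OF finite_pcrossings] show ?thesis unfolding w pwrithe_def .
qed

end

section \<open>Loops of a state\<close>

text \<open>Being constant along \<open>R\<close>, a label is an invariant of components; by
  \<open>conn\<close> it is a complete one on \<open>E\<close>.\<close>

lemma ncomp_eq_card_labels:
  assumes const: "\<And>x y. (x, y) \<in> R \<Longrightarrow> lab x = lab y"
    and conn: "\<And>x y. x \<in> E \<Longrightarrow> y \<in> E \<Longrightarrow> lab x = lab y \<Longrightarrow> (x, y) \<in> (R \<union> R\<inverse>)\<^sup>*"
  shows "ncomp E R = card (lab ` E)"
proof -
  have eq: "lab x = lab y" if "(x, y) \<in> (R \<union> R\<inverse>)\<^sup>*" for x y
    using that by induction (use const in auto)
  let ?Q = "{(x, y). x \<in> E \<and> y \<in> E \<and> (x, y) \<in> (R \<union> R\<inverse>)\<^sup>*}"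
  have "(x, y) \<in> (R \<union> R\<inverse>)\<^sup>* \<longleftrightarrow> lab x = lab y" if "x \<in> E" "y \<in> E" for x y
    using eq[of x y] conn[OF that] by (rule iffI)
  then have Q: "?Q = {(x, y). x \<in> E \<and> y \<in> E \<and> lab x = lab y}"
    by (simp cong: conj_cong)
  have "?Q `` {x} = {y \<in> E. lab y = lab x}" if "x \<in> E" for x
    unfolding Q using that by auto
  then have "E // ?Q = (\<lambda>l. {y \<in> E. lab y = l}) ` lab ` E"
    by (auto simp: quotient_def)
  moreover have "inj_on (\<lambda>l. {y \<in> E. lab y = l}) (lab ` E)"
    by (auto simp: inj_on_def)
  ultimately show ?thesis by (simp add: ncomp_def card_image)
qed

context pretzel
begin

section \<open>Loop labels and their invariance\<close>

definition hor :: "(crossing \<Rightarrow> bool) \<Rightarrow> nat \<Rightarrow> nat set" where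
  "hor s i = {j. j < col_len ns i \<and> s (i, j) \<noteq> tait_pos ns (i, j)}"

definition vert_cols :: "(crossing \<Rightarrow> bool) \<Rightarrow> nat set" where
  "vert_cols s = {i. i < length ns \<and> hor s i = {}}"

lemma finite_hor [simp]: "finite (hor s i)"
  by (simp add: hor_def)

lemma finite_vert_cols [simp]: "finite (vert_cols s)"
  by (simp add: vert_cols_def)

definition vert_before :: "(crossing \<Rightarrow> bool) \<Rightarrow> nat \<Rightarrow> nat" where
  "vert_before s g = card {i \<in> vert_cols s. i < g}"

lemma vert_before_Suc:
  "vert_before s (Suc g) = (if g \<in> vert_cols s then Suc (vert_before s g) else vert_before s g)"
proof -
  have "{i \<in> vert_cols s. i < Suc g} = (if g \<in> vert_cols s then insert g {i \<in> vert_cols s. i < g}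
      else {i \<in> vert_cols s. i < g})"
    by (auto simp: less_Suc_eq)
  then show ?thesis by (simp add: vert_before_def)
qed

lemma vert_before_0 [simp]: "vert_before s 0 = 0"
  by (simp add: vert_before_def)

lemma vert_before_length: "vert_before s (length ns) = card (vert_cols s)"
  by (auto simp: vert_before_def vert_cols_def intro: arg_cong[where f = card])

lemma vert_before_mono: "g \<le> g' \<Longrightarrow> vert_before s g \<le> vert_before s g'"
  by (auto simp: vert_before_def intro!: card_mono)

lemma vert_before_eq_imp:
  assumes "g \<le> g'" "vert_before s g = vert_before s g'" "g \<le> i" "i < g'"
  shows "i \<notin> vert_cols s"
proof
  assume "i \<in> vert_cols s"
  then have "vert_before s (Suc i) = Suc (vert_before s i)" by (simp add: vert_before_Suc)
  then show False using vert_before_mono[OF assms(3), of s] vert_before_mono[of "Suc i" g' s] assms by simp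
qed

text \<open>Loops are labelled as follows. If \<open>v > 0\<close> columns are smoothed vertically, the loop through the gap
  to the left of column \<open>g\<close> is labelled by the number of vertical columns before \<open>g\<close> modulo \<open>v\<close>; the
  modulus identifies the gap \<open>length ns\<close> with the gap 0, both being the outer region. If \<open>v = 0\<close>, the
  upper and the lower loop get the labels 0 and 1. A loop inside a column is labelled by the
  horizontally smoothed crossing at its top.\<close>
definition upper_label :: "(crossing \<Rightarrow> bool) \<Rightarrow> nat \<Rightarrow> nat" where
  "upper_label s g = (if vert_cols s = {} then 0 else vert_before s g mod card (vert_cols s))"

definition lower_label :: "(crossing \<Rightarrow> bool) \<Rightarrow> nat \<Rightarrow> nat" where
  "lower_label s g = (if vert_cols s = {} then 1 else vert_before s g mod card (vert_cols s))"

text \<open>The label of the strand of column \<open>i\<close> next to gap \<open>g\<close> at level \<open>l\<close>, the level between the crossings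
  \<open>l - 1\<close> and \<open>l\<close>.\<close>
definition point_label :: "(crossing \<Rightarrow> bool) \<Rightarrow> nat \<Rightarrow> nat \<Rightarrow> nat \<Rightarrow> (nat \<times> nat) + nat" where
  "point_label s i l g = (if \<forall>j\<in>hor s i. l \<le> j then Inr (upper_label s g)
     else if \<forall>j\<in>hor s i. j < l then Inr (lower_label s g)
     else Inl (i, Max {j \<in> hor s i. j < l}))"

fun end_label :: "(crossing \<Rightarrow> bool) \<Rightarrow> dend \<Rightarrow> (nat \<times> nat) + nat" where
  "end_label s ((i, j), NW) = point_label s i j i"
| "end_label s ((i, j), NE) = point_label s i j (Suc i)"
| "end_label s ((i, j), SW) = point_label s i (Suc j) i"
| "end_label s ((i, j), SE) = point_label s i (Suc j) (Suc i)"

lemma labels_Suc: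
  assumes "i \<notin> vert_cols s"
  shows "upper_label s (Suc i) = upper_label s i" "lower_label s (Suc i) = lower_label s i"
  using assms by (simp_all add: upper_label_def lower_label_def vert_before_Suc)

lemma labels_length:
  "upper_label s (length ns) = upper_label s 0" "lower_label s (length ns) = lower_label s 0"
  by (simp_all add: upper_label_def lower_label_def vert_before_length)

lemma point_label_0 [simp]: "point_label s i 0 g = Inr (upper_label s g)"
  by (simp add: point_label_def)

lemma point_label_bottom [simp]:
  assumes "i < length ns"
  shows "point_label s i (col_len ns i) g = Inr (lower_label s g)"
proof (cases "i \<in> vert_cols s")
  \<comment> \<open>An all-vertical column passes the first test of \<open>point_label\<close>,
    which yields \<open>upper_label\<close>; the two labels agree once a vertical column
    exists.\<close>
  case True
  then have "vert_cols s \<noteq> {}" "hor s i = {}" by (auto simp: vert_cols_def)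
  then show ?thesis by (simp add: point_label_def upper_label_def lower_label_def)
next
  case False
  then have "\<exists>j\<in>hor s i. True" using assms by (auto simp: vert_cols_def)
  moreover have "j < col_len ns i" if "j \<in> hor s i" for j using that by (simp add: hor_def)
  ultimately show ?thesis unfolding point_label_def by (simp add: not_le) (metis not_le)
qed

lemma point_label_vertical:
  assumes "j \<notin> hor s i"
  shows "point_label s i (Suc j) g = point_label s i j g"
proof -
  have "Suc j \<le> x \<longleftrightarrow> j \<le> x" "x < Suc j \<longleftrightarrow> x < j" if "x \<in> hor s i" for x
    using that assms by (metis Suc_leI le_neq_implies_less less_imp_le_nat Suc_le_lessD order_refl,
      metis assms less_Suc_eq that)
  then show ?thesis unfolding point_label_def by (smt (verit) Collect_cong)
qed

lemma point_label_horizontal: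
  assumes "j \<in> hor s i"
  shows "point_label s i j i = point_label s i j (Suc i)"
    "point_label s i (Suc j) i = point_label s i (Suc j) (Suc i)"
proof -
  have "i \<notin> vert_cols s" using assms by (auto simp: vert_cols_def)
  then show "point_label s i j i = point_label s i j (Suc i)"
    "point_label s i (Suc j) i = point_label s i (Suc j) (Suc i)"
    by (simp_all add: point_label_def labels_Suc)
qed

lemma end_label_parcs:
  assumes "(x, y) \<in> parcs ns"
  shows "end_label s x = end_label s y"
proof -
  have k: "ns \<noteq> []" "Suc (length ns - Suc 0) = length ns" using nonempty by auto
  have m: "Suc (col_len ns i - Suc 0) = col_len ns i" if "i < length ns" for i
    using col_len_pos[OF that] by simp
  have b: "point_label s i (Suc (col_len ns i - Suc 0)) g = Inr (lower_label s g)"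
    if "i < length ns" for i g
    using that by (simp add: m)
  show ?thesis using assms unfolding parcs_def Un_iff
    by (elim disjE CollectE exE conjE insertE emptyE; simp add: b k(1); simp add: k labels_length)
qed

lemma end_label_smooth:
  assumes "(x, y) \<in> smooth_rel ns s"
  shows "end_label s x = end_label s y"
proof -
  have "j \<notin> hor s i" if "s (i, j) = tait_pos ns (i, j)" for i j
    using that by (auto simp: hor_def)
  moreover have "j \<in> hor s i" if "(i, j) \<in> pcrossings ns" "s (i, j) \<noteq> tait_pos ns (i, j)" for i j
    using that by (auto simp: hor_def)
  ultimately show ?thesis using assms unfolding smooth_rel_def
    by (elim UnE CollectE exE conjE)
       (simp_all add: point_label_vertical point_label_horizontal split_paired_all)
qed

section \<open>Ends with equal labels are connected\<close>

definition end_conn :: "(crossing \<Rightarrow> bool) \<Rightarrow> (dend \<times> dend) set" where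
  "end_conn s = ((parcs ns \<union> smooth_rel ns s) \<union> (parcs ns \<union> smooth_rel ns s)\<inverse>)\<^sup>*"

lemma end_conn_refl [simp]: "(x, x) \<in> end_conn s"
  by (simp add: end_conn_def)

lemma end_conn_trans: "(x, y) \<in> end_conn s \<Longrightarrow> (y, z) \<in> end_conn s \<Longrightarrow> (x, z) \<in> end_conn s"
  unfolding end_conn_def by (rule rtrancl_trans)

lemma end_conn_sym: "(x, y) \<in> end_conn s \<Longrightarrow> (y, x) \<in> end_conn s"
  unfolding end_conn_def by (rule symD[OF sym_rtrancl[OF sym_Un_converse]])

lemma end_conn_arc: "(x, y) \<in> parcs ns \<Longrightarrow> (x, y) \<in> end_conn s"
  unfolding end_conn_def by (intro r_into_rtrancl) simp

lemma end_conn_smooth: "(x, y) \<in> smooth_rel ns s \<Longrightarrow> (x, y) \<in> end_conn s"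
  unfolding end_conn_def by (intro r_into_rtrancl) simp

text \<open>The flag selects the left or the right strand, so that one argument handles
  both.\<close>

definition nend :: "nat \<Rightarrow> nat \<Rightarrow> bool \<Rightarrow> dend" where
  "nend i j b = ((i, j), if b then NW else NE)"

definition send :: "nat \<Rightarrow> nat \<Rightarrow> bool \<Rightarrow> dend" where
  "send i j b = ((i, j), if b then SW else SE)"

lemma send_nend_conn:
  assumes "i < length ns" "Suc j < col_len ns i"
  shows "(send i j b, nend i (Suc j) b) \<in> end_conn s"
  by (rule end_conn_arc, cases b) (use assms in \<open>simp_all add: parcs_def send_def nend_def\<close>)

lemma vertical_conn:
  assumes "i < length ns" "j < col_len ns i" "j \<notin> hor s i"
  shows "(nend i j b, send i j b) \<in> end_conn s"
  by (rule end_conn_smooth, cases b) (use assms in \<open>simp_all add: smooth_rel_def send_def nend_def hor_def\<close>)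

lemma horizontal_conn:
  assumes "i < length ns" "j \<in> hor s i"
  shows "(nend i j b, nend i j b') \<in> end_conn s" "(send i j b, send i j b') \<in> end_conn s"
proof -
  have "(nend i j True, nend i j False) \<in> end_conn s"
    by (rule end_conn_smooth) (use assms in \<open>auto simp: smooth_rel_def nend_def hor_def\<close>)
  then show "(nend i j b, nend i j b') \<in> end_conn s"
    using end_conn_sym by (cases b; cases b') auto
  have "(send i j True, send i j False) \<in> end_conn s"
    by (rule end_conn_smooth) (use assms in \<open>auto simp: smooth_rel_def send_def hor_def\<close>)
  then show "(send i j b, send i j b') \<in> end_conn s"
    using end_conn_sym by (cases b; cases b') auto
qed

lemma nend_send_conn:
  assumes "i < length ns" "a \<le> j" "j < col_len ns i" "\<And>t. t \<in> hor s i \<Longrightarrow> t < a \<or> j < t"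
  shows "(nend i a b, send i j b) \<in> end_conn s"
  using assms(2,3,4)
proof (induction j rule: dec_induct)
  case base
  then show ?case using assms(1) by (intro vertical_conn) auto
next
  case (step j)
  have "(nend i a b, send i j b) \<in> end_conn s"
    using step.prems by (intro step.IH) (force+)
  moreover have "(send i j b, nend i (Suc j) b) \<in> end_conn s"
    using step assms(1) by (intro send_nend_conn) auto
  moreover have "(nend i (Suc j) b, send i (Suc j) b) \<in> end_conn s"
    using step.prems(1) step.prems(2)[of "Suc j"] step.hyps(1) assms(1)
    by (intro vertical_conn) auto
  ultimately show ?case by (blast intro: end_conn_trans)
qed

lemma nend_nend_conn:
  assumes "i < length ns" "a \<le> j" "j < col_len ns i" "\<And>t. t \<in> hor s i \<Longrightarrow> t < a \<or> j \<le> t"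
  shows "(nend i a b, nend i j b) \<in> end_conn s"
proof (cases "a = j")
  case False
  then obtain l where j: "j = Suc l" "a \<le> l" using assms(2) by (cases j) auto
  have "(nend i a b, send i l b) \<in> end_conn s"
    using assms j by (intro nend_send_conn) (auto simp: Suc_le_eq)
  moreover have "(send i l b, nend i j b) \<in> end_conn s"
    using assms j by (auto intro: send_nend_conn)
  ultimately show ?thesis by (rule end_conn_trans)
qed simp

lemma send_send_conn:
  assumes "i < length ns" "a \<le> j" "j < col_len ns i" "\<And>t. t \<in> hor s i \<Longrightarrow> t \<le> a \<or> j < t"
  shows "(send i a b, send i j b) \<in> end_conn s"
proof (cases "a = j")
  case False
  then have "(send i a b, nend i (Suc a) b) \<in> end_conn s"
    using assms by (intro send_nend_conn) auto
  moreover have "(nend i (Suc a) b, send i j b) \<in> end_conn s"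
    using assms False by (intro nend_send_conn) (auto simp: less_Suc_eq_le)
  ultimately show ?thesis by (rule end_conn_trans)
qed simp

lemma send_nend_conn':
  assumes "i < length ns" "a < j" "j < col_len ns i" "\<And>t. t \<in> hor s i \<Longrightarrow> t \<le> a \<or> j \<le> t"
  shows "(send i a b, nend i j b) \<in> end_conn s"
proof -
  have "(send i a b, nend i (Suc a) b) \<in> end_conn s"
    using assms by (intro send_nend_conn) auto
  moreover have "(nend i (Suc a) b, nend i j b) \<in> end_conn s"
    using assms by (intro nend_nend_conn) (auto simp: less_Suc_eq_le)
  ultimately show ?thesis by (rule end_conn_trans)
qed

text \<open>A representative end at the top of each gap; the gap \<open>length ns\<close> is the gap
  0 again, closed up through the outer arc.\<close>

definition tgap :: "nat \<Rightarrow> dend" where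
  "tgap g = (if g < length ns then nend g 0 True else nend 0 0 True)"

definition bgap :: "nat \<Rightarrow> dend" where
  "bgap g = (if g < length ns then send g (col_len ns g - 1) True else send 0 (col_len ns 0 - 1) True)"

lemma nend_tgap_conn:
  assumes "i < length ns"
  shows "(nend i 0 b, tgap (if b then i else Suc i)) \<in> end_conn s"
proof (cases b)
  case False
  show ?thesis
  proof (cases "Suc i < length ns")
    case True
    then have "(nend i 0 False, nend (Suc i) 0 True) \<in> parcs ns" by (auto simp: parcs_def nend_def)
    then show ?thesis using False True by (simp add: tgap_def end_conn_arc)
  next
    case i: False
    then have "i = length ns - 1" using assms by simp
    then have "(nend 0 0 True, nend i 0 False) \<in> parcs ns" by (auto simp: parcs_def nend_def)
    then show ?thesis using False i by (simp add: tgap_def end_conn_arc end_conn_sym)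
  qed
qed (use assms in \<open>simp add: tgap_def\<close>)

lemma send_bgap_conn:
  assumes "i < length ns"
  shows "(send i (col_len ns i - 1) b, bgap (if b then i else Suc i)) \<in> end_conn s"
proof (cases b)
  case False
  show ?thesis
  proof (cases "Suc i < length ns")
    case True
    then have "(send i (col_len ns i - 1) False, send (Suc i) (col_len ns (Suc i) - 1) True) \<in> parcs ns"
      by (auto simp: parcs_def send_def)
    then show ?thesis using False True by (simp add: bgap_def end_conn_arc)
  next
    case i: False
    then have "i = length ns - 1" using assms by simp
    then have "(send 0 (col_len ns 0 - 1) True, send i (col_len ns i - 1) False) \<in> parcs ns"
      by (auto simp: parcs_def send_def)
    then show ?thesis using False i by (simp add: bgap_def end_conn_arc end_conn_sym)
  qed
qed (use assms in \<open>simp add: bgap_def\<close>)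

text \<open>The topmost horizontally smoothed crossing joins the two strands that descend from the
  top of the column.\<close>

lemma tgap_Suc_conn:
  assumes "i < length ns" "i \<notin> vert_cols s"
  shows "(tgap i, tgap (Suc i)) \<in> end_conn s"
proof -
  have ne: "hor s i \<noteq> {}" using assms by (simp add: vert_cols_def)
  define u where "u = Min (hor s i)"
  have u: "u \<in> hor s i" "u < col_len ns i" using ne Min_in[of "hor s i"] by (auto simp: u_def hor_def)
  have c: "(nend i 0 b, nend i u b) \<in> end_conn s" for b
    using assms u by (intro nend_nend_conn) (auto simp: u_def)
  have "(nend i 0 True, nend i 0 False) \<in> end_conn s"
    using c horizontal_conn(1)[OF assms(1) u(1)] by (meson end_conn_sym end_conn_trans)
  then show ?thesis
    using nend_tgap_conn[OF assms(1), of True] nend_tgap_conn[OF assms(1), of False]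
    by simp (meson end_conn_sym end_conn_trans)
qed

lemma bgap_Suc_conn:
  assumes "i < length ns" "i \<notin> vert_cols s"
  shows "(bgap i, bgap (Suc i)) \<in> end_conn s"
proof -
  have ne: "hor s i \<noteq> {}" using assms by (simp add: vert_cols_def)
  define u where "u = Max (hor s i)"
  have u: "u \<in> hor s i" "u < col_len ns i" using ne Max_in[of "hor s i"] by (auto simp: u_def hor_def)
  have c: "(send i u b, send i (col_len ns i - 1) b) \<in> end_conn s" for b
    using assms u by (intro send_send_conn) (auto simp: u_def)
  have "(send i (col_len ns i - 1) True, send i (col_len ns i - 1) False) \<in> end_conn s"
    using c horizontal_conn(2)[OF assms(1) u(1)] by (meson end_conn_sym end_conn_trans)
  then show ?thesis
    using send_bgap_conn[OF assms(1), of True] send_bgap_conn[OF assms(1), of False]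
    by simp (meson end_conn_sym end_conn_trans)
qed

lemma gap_range_conn:
  assumes "g \<le> g'" "g' \<le> length ns" "\<And>i. g \<le> i \<Longrightarrow> i < g' \<Longrightarrow> i \<notin> vert_cols s"
  shows "(tgap g, tgap g') \<in> end_conn s \<and> (bgap g, bgap g') \<in> end_conn s"
  using assms
proof (induction g' rule: dec_induct)
  case (step n)
  then have "(tgap g, tgap n) \<in> end_conn s \<and> (bgap g, bgap n) \<in> end_conn s" by simp
  then show ?case using tgap_Suc_conn[of n s] bgap_Suc_conn[of n s] step
    by (auto intro: end_conn_trans)
qed simp

lemma vert_col_gap_conn:
  assumes "i \<in> vert_cols s"
  shows "(tgap i, bgap i) \<in> end_conn s" "(tgap (Suc i), bgap (Suc i)) \<in> end_conn s"
proof -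
  have i: "i < length ns" "hor s i = {}" using assms by (auto simp: vert_cols_def)
  have "(nend i 0 b, send i (col_len ns i - 1) b) \<in> end_conn s" for b
    using i col_len_pos[of i] by (intro nend_send_conn) auto
  then have "(tgap (if b then i else Suc i), bgap (if b then i else Suc i)) \<in> end_conn s" for b
    using nend_tgap_conn[OF i(1), of b s] send_bgap_conn[OF i(1), of b s]
    by (meson end_conn_sym end_conn_trans)
  from this[of True] this[of False]
  show "(tgap i, bgap i) \<in> end_conn s" "(tgap (Suc i), bgap (Suc i)) \<in> end_conn s" by simp_all
qed

text \<open>From the gap one reaches, without passing a vertical column, the next vertical column to
  the right or else the last one on the left, and descends along it.\<close>

lemma tgap_bgap_conn:
  assumes "vert_cols s \<noteq> {}" "g \<le> length ns"
  shows "(tgap g, bgap g) \<in> end_conn s"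
proof (cases "\<exists>i\<in>vert_cols s. g \<le> i")
  case True
  define i where "i = (LEAST i. i \<in> vert_cols s \<and> g \<le> i)"
  have i: "i \<in> vert_cols s" "g \<le> i" using LeastI_ex[of "\<lambda>i. i \<in> vert_cols s \<and> g \<le> i"] True
    by (auto simp: i_def)
  have "t \<notin> vert_cols s" if "g \<le> t" "t < i" for t
    using not_less_Least[of t "\<lambda>i. i \<in> vert_cols s \<and> g \<le> i"] that by (auto simp: i_def)
  then have "(tgap g, tgap i) \<in> end_conn s \<and> (bgap g, bgap i) \<in> end_conn s"
    using i by (intro gap_range_conn) (auto simp: vert_cols_def)
  then show ?thesis using vert_col_gap_conn(1)[OF i(1)] by (meson end_conn_sym end_conn_trans)
next
  case False
  define i where "i = Max (vert_cols s)"
  have i: "i \<in> vert_cols s" "i < g" using assms Max_in[of "vert_cols s"] False by (auto simp: i_def)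
  have "t \<notin> vert_cols s" if "Suc i \<le> t" for t
  proof
    assume "t \<in> vert_cols s"
    then have "t \<le> i" unfolding i_def by simp
    then show False using that by simp
  qed
  then have "(tgap (Suc i), tgap g) \<in> end_conn s \<and> (bgap (Suc i), bgap g) \<in> end_conn s"
    using i assms by (intro gap_range_conn) auto
  then show ?thesis using vert_col_gap_conn(2)[OF i(1)] by (meson end_conn_sym end_conn_trans)
qed

lemma gap_conn_vert_before:
  assumes "g \<le> length ns" "g' \<le> length ns" "vert_before s g = vert_before s g'"
  shows "(tgap g, tgap g') \<in> end_conn s \<and> (bgap g, bgap g') \<in> end_conn s"
  using assms
proof (induction g g' rule: linorder_wlog)
  case (le g g')
  then show ?case using vert_before_eq_imp[of g g' s] by (intro gap_range_conn) auto
next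
  case (sym g g')
  then show ?case by (auto intro: end_conn_sym)
qed

text \<open>Both counts lie between 0 and the number v of vertical columns, so equal residues mean
  equal counts or the pair 0 and v. The latter is settled by passing through the gap
  \<open>length ns\<close>, which is the gap 0.\<close>

lemma gap_conn_mod:
  assumes "g \<le> length ns" "g' \<le> length ns"
    "vert_before s g mod card (vert_cols s) = vert_before s g' mod card (vert_cols s)"
  shows "(tgap g, tgap g') \<in> end_conn s \<and> (bgap g, bgap g') \<in> end_conn s"
proof -
  let ?v = "card (vert_cols s)"
  have wrap: "tgap (length ns) = tgap 0" "bgap (length ns) = bgap 0"
    using nonempty by (simp_all add: tgap_def bgap_def)
  have le: "vert_before s g \<le> ?v" "vert_before s g' \<le> ?v"
    using vert_before_mono[of _ "length ns" s] assms by (simp_all add: vert_before_length)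
  consider "vert_before s g = vert_before s g'" | "vert_before s g = ?v" "vert_before s g' = 0"
    | "vert_before s g = 0" "vert_before s g' = ?v"
    using le assms(3) by (cases "vert_before s g = ?v"; cases "vert_before s g' = ?v") auto
  then show ?thesis
  proof cases
    case 1
    then show ?thesis using assms by (intro gap_conn_vert_before) auto
  next
    case 2
    then have "(tgap g, tgap (length ns)) \<in> end_conn s \<and> (bgap g, bgap (length ns)) \<in> end_conn s"
      using assms by (intro gap_conn_vert_before) (auto simp: vert_before_length)
    moreover have "(tgap 0, tgap g') \<in> end_conn s \<and> (bgap 0, bgap g') \<in> end_conn s"
      using 2 assms by (intro gap_conn_vert_before) auto
    ultimately show ?thesis using wrap by (auto intro: end_conn_trans)
  next
    case 3
    then have "(tgap (length ns), tgap g') \<in> end_conn s \<and> (bgap (length ns), bgap g') \<in> end_conn s"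
      using assms by (intro gap_conn_vert_before) (auto simp: vert_before_length)
    moreover have "(tgap g, tgap 0) \<in> end_conn s \<and> (bgap g, bgap 0) \<in> end_conn s"
      using 3 assms by (intro gap_conn_vert_before) auto
    ultimately show ?thesis using wrap by (auto intro: end_conn_trans)
  qed
qed

lemma gap_label_conn:
  assumes g: "g \<le> length ns" "g' \<le> length ns"
  shows "upper_label s g = upper_label s g' \<Longrightarrow> (tgap g, tgap g') \<in> end_conn s"
    and "lower_label s g = lower_label s g' \<Longrightarrow> (bgap g, bgap g') \<in> end_conn s"
    and "upper_label s g = lower_label s g' \<Longrightarrow> (tgap g, bgap g') \<in> end_conn s"
proof -
  have "(upper_label s g = upper_label s g' \<longrightarrow> (tgap g, tgap g') \<in> end_conn s) \<and>
    (lower_label s g = lower_label s g' \<longrightarrow> (bgap g, bgap g') \<in> end_conn s) \<and>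
    (upper_label s g = lower_label s g' \<longrightarrow> (tgap g, bgap g') \<in> end_conn s)"
  proof (cases "vert_cols s = {}")
    case True
    then have "vert_before s g = vert_before s g'" by (simp add: vert_before_def)
    then show ?thesis
      using gap_conn_vert_before[OF g, of s] True by (simp add: upper_label_def lower_label_def)
  next
    case False
    then show ?thesis
      using gap_conn_mod[OF g, of s] end_conn_trans[OF _ tgap_bgap_conn[OF False g(2)], of "tgap g"]
      by (auto simp: upper_label_def lower_label_def)
  qed
  then show "upper_label s g = upper_label s g' \<Longrightarrow> (tgap g, tgap g') \<in> end_conn s"
    and "lower_label s g = lower_label s g' \<Longrightarrow> (bgap g, bgap g') \<in> end_conn s"
    and "upper_label s g = lower_label s g' \<Longrightarrow> (tgap g, bgap g') \<in> end_conn s"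
    by simp_all
qed

text \<open>Each label gets a canonical end, \<open>send i u True\<close>, \<open>tgap g\<close> or
  \<open>bgap g\<close>. An end reaches it along its own strand, going to the nearest horizontal
  smoothing above or to the top or bottom of the column.\<close>

lemma point_cases:
  assumes i: "i < length ns"
    and x: "x = nend i j b \<and> l = j \<or> x = send i j b \<and> l = Suc j"
    and j: "j < col_len ns i"
  defines "g \<equiv> if b then i else Suc i"
  shows "(\<exists>u. point_label s i l g = Inl (i, u) \<and> (send i u True, x) \<in> end_conn s) \<or>
    (point_label s i l g = Inr (upper_label s g) \<and> (tgap g, x) \<in> end_conn s) \<or>
    (point_label s i l g = Inr (lower_label s g) \<and> (bgap g, x) \<in> end_conn s)"
proof -
  consider "\<forall>t\<in>hor s i. l \<le> t" | "\<not> (\<forall>t\<in>hor s i. l \<le> t)" "\<forall>t\<in>hor s i. t < l"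
    | "\<not> (\<forall>t\<in>hor s i. l \<le> t)" "\<not> (\<forall>t\<in>hor s i. t < l)" by blast
  then show ?thesis
  proof cases
    case 1
    have "(nend i 0 b, x) \<in> end_conn s"
      using x
    proof (elim disjE conjE)
      assume "x = nend i j b" "l = j"
      then show ?thesis using 1 i j by (auto intro!: nend_nend_conn)
    next
      assume "x = send i j b" "l = Suc j"
      then show ?thesis using 1 i j by (auto intro!: nend_send_conn simp: Suc_le_eq)
    qed
    then have "(tgap g, x) \<in> end_conn s"
      using nend_tgap_conn[OF i, of b s] unfolding g_def by (blast intro: end_conn_trans end_conn_sym)
    then show ?thesis using 1 by (simp add: point_label_def)
  next
    case 2
    have "(x, send i (col_len ns i - 1) b) \<in> end_conn s"
      using x
    proof (elim disjE conjE)
      assume "x = nend i j b" "l = j"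
      then show ?thesis using 2 i j by (auto intro!: nend_send_conn)
    next
      assume "x = send i j b" "l = Suc j"
      then show ?thesis using 2 i j by (auto intro!: send_send_conn simp: less_Suc_eq_le)
    qed
    then have "(bgap g, x) \<in> end_conn s"
      using send_bgap_conn[OF i, of b s] unfolding g_def by (blast intro: end_conn_trans end_conn_sym)
    moreover have "point_label s i l g = Inr (lower_label s g)"
      unfolding point_label_def if_not_P[OF 2(1)] if_P[OF 2(2)] by (rule refl)
    ultimately show ?thesis by blast
  next
    case 3
    let ?B = "{t \<in> hor s i. t < l}"
    define u where "u = Max ?B"
    have "?B \<noteq> {}" "finite ?B" using 3 by (auto simp: not_le)
    then have u: "u \<in> hor s i" "u < l" using Max_in[of ?B] by (auto simp: u_def)
    have max: "t \<le> u \<or> l \<le> t" if "t \<in> hor s i" for t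
    proof (cases "t < l")
      case True
      then have "t \<in> ?B" using that by simp
      then show ?thesis using \<open>finite ?B\<close> by (simp add: u_def)
    qed simp
    have "(send i u b, x) \<in> end_conn s"
      using x
    proof (elim disjE conjE)
      assume "x = nend i j b" "l = j"
      then show ?thesis using u max i j by (auto intro!: send_nend_conn')
    next
      assume "x = send i j b" "l = Suc j"
      then show ?thesis using u max i j by (auto intro!: send_send_conn simp: Suc_le_eq)
    qed
    then have "(send i u True, x) \<in> end_conn s"
      using horizontal_conn(2)[OF i u(1)] by (blast intro: end_conn_trans)
    moreover have "point_label s i l g = Inl (i, u)"
      unfolding point_label_def u_def if_not_P[OF 3(1)] if_not_P[OF 3(2)] by (rule refl)
    ultimately show ?thesis by blast
  qed
qed

lemma end_cases:
  assumes "x \<in> dends ns"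
  shows "(\<exists>i u. end_label s x = Inl (i, u) \<and> (send i u True, x) \<in> end_conn s) \<or>
    (\<exists>g\<le>length ns. end_label s x = Inr (upper_label s g) \<and> (tgap g, x) \<in> end_conn s) \<or>
    (\<exists>g\<le>length ns. end_label s x = Inr (lower_label s g) \<and> (bgap g, x) \<in> end_conn s)"
proof -
  obtain i j c where x: "x = ((i, j), c)" "i < length ns" "j < col_len ns i"
    using assms by (auto simp: dends_def)
  define b where "b = (c = NW \<or> c = SW)"
  define l where "l = (if c = NW \<or> c = NE then j else Suc j)"
  have xe: "x = nend i j b \<and> l = j \<or> x = send i j b \<and> l = Suc j"
    by (cases c) (simp_all add: x b_def l_def nend_def send_def)
  have lab: "end_label s x = point_label s i l (if b then i else Suc i)"
    by (cases c) (simp_all add: x b_def l_def)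
  have "(if b then i else Suc i) \<le> length ns" using x by auto
  then show ?thesis
    using point_cases[OF x(2) xe x(3), of s] unfolding lab by blast
qed

lemma end_label_conn:
  assumes "x \<in> dends ns" "y \<in> dends ns" "end_label s x = end_label s y"
  shows "(x, y) \<in> end_conn s"
proof -
  have via: "(x, y) \<in> end_conn s" if "(p, x) \<in> end_conn s" "(q, y) \<in> end_conn s" "(p, q) \<in> end_conn s" for p q
    using that by (blast intro: end_conn_trans end_conn_sym)
  show ?thesis
    using end_cases[OF assms(1), of s] end_cases[OF assms(2), of s]
  proof (elim disjE exE conjE)
    fix i u i' u'
    assume "end_label s x = Inl (i, u)" "(send i u True, x) \<in> end_conn s"
      "end_label s y = Inl (i', u')" "(send i' u' True, y) \<in> end_conn s"
    then show ?thesis using assms(3) via by simp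
  next
    fix g g' assume "g \<le> length ns" "g' \<le> length ns"
      "end_label s x = Inr (upper_label s g)" "(tgap g, x) \<in> end_conn s"
      "end_label s y = Inr (upper_label s g')" "(tgap g', y) \<in> end_conn s"
    then show ?thesis using assms(3) via[of "tgap g" "tgap g'"] gap_label_conn(1)[of g g' s] by simp
  next
    fix g g' assume "g \<le> length ns" "g' \<le> length ns"
      "end_label s x = Inr (upper_label s g)" "(tgap g, x) \<in> end_conn s"
      "end_label s y = Inr (lower_label s g')" "(bgap g', y) \<in> end_conn s"
    then show ?thesis using assms(3) via[of "tgap g" "bgap g'"] gap_label_conn(3)[of g g' s] by simp
  next
    fix g g' assume "g \<le> length ns" "g' \<le> length ns"
      "end_label s x = Inr (lower_label s g)" "(bgap g, x) \<in> end_conn s"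
      "end_label s y = Inr (upper_label s g')" "(tgap g', y) \<in> end_conn s"
    then show ?thesis
      using assms(3) via[of "bgap g" "tgap g'"] end_conn_sym[OF gap_label_conn(3)[of g' g s]] by simp
  next
    fix g g' assume "g \<le> length ns" "g' \<le> length ns"
      "end_label s x = Inr (lower_label s g)" "(bgap g, x) \<in> end_conn s"
      "end_label s y = Inr (lower_label s g')" "(bgap g', y) \<in> end_conn s"
    then show ?thesis using assms(3) via[of "bgap g" "bgap g'"] gap_label_conn(2)[of g g' s] by simp
  qed (use assms(3) in simp_all)
qed

section \<open>The number of labels\<close>

definition inner_loops :: "(crossing \<Rightarrow> bool) \<Rightarrow> (nat \<times> nat) set" where
  "inner_loops s = Sigma {..<length ns} (\<lambda>i. {u \<in> hor s i. \<exists>u'\<in>hor s i. u < u'})"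

text \<open>Vertical columns, if there are any, cut the diagram cyclically into as many sectors,
  with one loop each; without them an upper and a lower loop run all the way round.\<close>

definition outer_loops :: "(crossing \<Rightarrow> bool) \<Rightarrow> nat" where
  "outer_loops s = (if vert_cols s = {} then 2 else card (vert_cols s))"

lemma vert_before_surj:
  assumes "n \<le> vert_before s g"
  shows "\<exists>g'\<le>g. vert_before s g' = n"
  using assms
proof (induction g)
  case (Suc g)
  then show ?case
    by (cases "n \<le> vert_before s g") (auto simp: vert_before_Suc le_Suc_eq split: if_splits)
qed simp

lemma end_label_image: "end_label s ` dends ns = Inl ` inner_loops s \<union> Inr ` {..<outer_loops s}"
proof (intro equalityI subsetI)
  fix y assume "y \<in> end_label s ` dends ns"
  then obtain i j c where x: "y = end_label s ((i, j), c)" "i < length ns" "j < col_len ns i"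
    by (auto simp: dends_def)
  obtain l g where y: "y = point_label s i l g" unfolding x(1) by (cases c) auto
  have "upper_label s g < outer_loops s" "lower_label s g < outer_loops s"
    by (auto simp: upper_label_def lower_label_def outer_loops_def card_gt_0_iff)
  moreover have "(i, Max {t \<in> hor s i. t < l}) \<in> inner_loops s"
    if "\<not> (\<forall>t\<in>hor s i. l \<le> t)" "\<not> (\<forall>t\<in>hor s i. t < l)"
  proof -
    let ?B = "{t \<in> hor s i. t < l}"
    have "?B \<noteq> {}" "finite ?B" using that by (auto simp: not_le)
    then have "Max ?B \<in> ?B" by (intro Max_in)
    then show ?thesis using that x(2) by (auto simp: inner_loops_def not_less intro: less_le_trans)
  qed
  ultimately show "y \<in> Inl ` inner_loops s \<union> Inr ` {..<outer_loops s}"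
    unfolding y point_label_def by simp
next
  fix y assume "y \<in> Inl ` inner_loops s \<union> Inr ` {..<outer_loops s}"
  then consider (inner) i u where "y = Inl (i, u)" "(i, u) \<in> inner_loops s"
    | (outer) n where "y = Inr n" "n < outer_loops s" by auto
  then show "y \<in> end_label s ` dends ns"
  proof cases
    case inner
    then obtain u' where u: "i < length ns" "u \<in> hor s i" "u' \<in> hor s i" "u < u'"
      by (auto simp: inner_loops_def)
    have "Max {t \<in> hor s i. t < Suc u} = u" using u by (intro Max_eqI) auto
    then have "point_label s i (Suc u) i = Inl (i, u)"
      using u unfolding point_label_def by (auto simp: not_le not_less)
    then have "y = end_label s ((i, u), SW)" using inner by simp
    moreover have "((i, u), SW) \<in> dends ns" using u by (auto simp: dends_def hor_def)
    ultimately show ?thesis by (rule image_eqI)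
  next
    case outer
    have k: "0 < length ns" "0 < col_len ns 0" using nonempty col_len_pos[of 0] by auto
    show ?thesis
    proof (cases "vert_cols s = {}")
      case True
      then consider "n = 0" | "n = 1" using outer by (auto simp: outer_loops_def less_2_cases_iff)
      then show ?thesis
      proof cases
        case 1
        then show ?thesis using outer True k
          by (intro image_eqI[of _ _ "((0, 0), NW)"]) (auto simp: upper_label_def dends_def)
      next
        case 2
        then show ?thesis using outer True k
          by (intro image_eqI[of _ _ "((0, col_len ns 0 - 1), SW)"]) (auto simp: lower_label_def dends_def)
      qed
    next
      case False
      then have n: "n < card (vert_cols s)" using outer by (simp add: outer_loops_def)
      then obtain g where g: "g \<le> length ns" "vert_before s g = n"
        using vert_before_surj[of n s "length ns"] by (auto simp: vert_before_length)
      \<comment> \<open>At the gap \<open>length ns\<close> the count is the number of vertical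
        columns, which exceeds \<open>n\<close>.\<close>
      then have "g < length ns" using n by (auto simp: vert_before_length le_less)
      then show ?thesis using outer False n g col_len_pos[of g]
        by (intro image_eqI[of _ _ "((g, 0), NW)"]) (auto simp: upper_label_def dends_def)
    qed
  qed
qed

lemma card_below_some: "finite B \<Longrightarrow> card {u \<in> B. \<exists>u'\<in>B. u < u'} = card B - (1::nat)" for B :: "nat set"
proof (cases "B = {}")
  case False
  assume B: "finite B"
  have "{u \<in> B. \<exists>u'\<in>B. u < u'} = B - {Max B}"
  proof (intro equalityI subsetI)
    fix u assume "u \<in> {u \<in> B. \<exists>u'\<in>B. u < u'}"
    then obtain u' where "u \<in> B" "u' \<in> B" "u < u'" by auto
    moreover have "u' \<le> Max B" using B \<open>u' \<in> B\<close> by simp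
    ultimately show "u \<in> B - {Max B}" by auto
  next
    fix u assume u: "u \<in> B - {Max B}"
    then have "u \<le> Max B" using B by simp
    then have "u < Max B" using u by simp
    then show "u \<in> {u \<in> B. \<exists>u'\<in>B. u < u'}" using u B False Max_in by blast
  qed
  then show ?thesis using B False by simp
qed simp

lemma state_loops_eq:
  "state_loops ns s = (\<Sum>i<length ns. card (hor s i) - 1) + outer_loops s"
proof -
  have "state_loops ns s = card (end_label s ` dends ns)"
    unfolding state_loops_def
  proof (rule ncomp_eq_card_labels)
    show "end_label s x = end_label s y" if "(x, y) \<in> parcs ns \<union> smooth_rel ns s" for x y
      using that end_label_parcs end_label_smooth by blast
    show "(x, y) \<in> ((parcs ns \<union> smooth_rel ns s) \<union> (parcs ns \<union> smooth_rel ns s)\<inverse>)\<^sup>*"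
      if "x \<in> dends ns" "y \<in> dends ns" "end_label s x = end_label s y" for x y
      using end_label_conn[OF that] unfolding end_conn_def .
  qed
  also have "\<dots> = card (Inl ` inner_loops s :: (_ + nat) set) + card (Inr ` {..<outer_loops s} :: (nat \<times> nat + _) set)"
    unfolding end_label_image by (rule card_Un_disjoint) (auto simp: inner_loops_def)
  also have "\<dots> = card (inner_loops s) + outer_loops s" by (simp add: card_image)
  also have "card (inner_loops s) = (\<Sum>i<length ns. card (hor s i) - 1)"
    unfolding inner_loops_def by (simp add: card_below_some)
  finally show ?thesis .
qed

end

section \<open>The Kauffman bracket\<close>

lemma sum_Pow_insert:
  assumes "finite S" "x \<notin> S"
  shows "(\<Sum>B\<in>Pow (insert x S). f B) = (\<Sum>B\<in>Pow S. f B) + (\<Sum>B\<in>Pow S. f (insert x B))"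
proof -
  have "inj_on (insert x) (Pow S)" using assms(2) by (auto simp: inj_on_def)
  moreover have "Pow S \<inter> insert x ` Pow S = {}" using assms(2) by auto
  ultimately show ?thesis
    using assms(1) by (simp add: Pow_insert sum.union_disjoint sum.reindex)
qed

text \<open>Split by the smoothing of the last crossing. Adding it to a nonempty set creates one
  more loop, adding it to the empty set none; the terms from nonempty sets combine to the factor
  \<open>live_weight a\<close> by \<open>live_weight_eq\<close>.\<close>

lemma cap_weight_Pow:
  assumes "a \<noteq> 0"
  shows "(\<Sum>B\<in>Pow {..<m} - {{}}. (\<Prod>j<m. if j \<in> B then inverse a else a) * loop_value a ^ (card B - 1)) =
    cap_weight a m"
proof (induction m)
  case (Suc m)
  let ?w = "\<lambda>m B. (\<Prod>j<m. if j \<in> B then inverse a else a) * loop_value a ^ (card B - 1)"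
  let ?f = "\<lambda>m B. if B = {} then 0 else ?w m B"
  \<comment> \<open>Extending by 0 at the empty set lets the sums range over full power sets, as
    \<open>sum_Pow_insert\<close> needs.\<close>
  have nz: "(\<Sum>B\<in>Pow {..<m} - {{}}. ?w m B) = (\<Sum>B\<in>Pow {..<m}. ?f m B)" for m :: nat
    by (rule sum.mono_neutral_cong_left) auto
  have 1: "?f (Suc m) B = a * ?f m B" if "B \<in> Pow {..<m}" for B
    using that by (auto simp: algebra_simps)
  have 2: "?f (Suc m) (insert m B) =
      inverse a * loop_value a * ?f m B + (if B = {} then inverse a * a ^ m else 0)"
    if "B \<in> Pow {..<m}" for B
  proof -
    have fin: "finite B" "m \<notin> B" using that finite_subset by auto
    have p: "(\<Prod>j<m. if j \<in> insert m B then inverse a else a) = (\<Prod>j<m. if j \<in> B then inverse a else a)"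
      by (intro prod.cong) auto
    show ?thesis
    proof (cases "B = {}")
      case True
      then show ?thesis using p by simp
    next
      case False
      then have "loop_value a ^ (card (insert m B) - 1) = loop_value a * loop_value a ^ (card B - 1)"
        using fin by (cases "card B") auto
      then show ?thesis using p False by (simp add: algebra_simps)
    qed
  qed
  have "(\<Sum>B\<in>Pow {..<Suc m}. ?f (Suc m) B) =
     (\<Sum>B\<in>Pow {..<m}. ?f (Suc m) B) + (\<Sum>B\<in>Pow {..<m}. ?f (Suc m) (insert m B))"
    unfolding lessThan_Suc by (rule sum_Pow_insert) auto
  also have "(\<Sum>B\<in>Pow {..<m}. ?f (Suc m) B) = a * (\<Sum>B\<in>Pow {..<m}. ?f m B)"
    unfolding sum_distrib_left by (rule sum.cong[OF refl 1])
  also have "(\<Sum>B\<in>Pow {..<m}. ?f (Suc m) (insert m B)) = (\<Sum>B\<in>Pow {..<m}.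
      inverse a * loop_value a * ?f m B + (if B = {} then inverse a * a ^ m else 0))"
    by (rule sum.cong[OF refl 2])
  also have "\<dots> = inverse a * loop_value a * (\<Sum>B\<in>Pow {..<m}. ?f m B) + inverse a * a ^ m"
    unfolding sum.distrib sum_distrib_left by (simp add: sum.delta)
  also have "a * (\<Sum>B\<in>Pow {..<m}. ?f m B) + \<dots> = cap_weight a (Suc m)"
    using Suc unfolding nz cap_weight.simps live_weight_eq[OF assms] by (simp add: algebra_simps)
  finally show ?case unfolding nz .
qed simp

text \<open>The summation index \<open>t\<close> is the last index satisfying \<open>P\<close>. This replaces the quotient
  \<open>(d ^ v - 0 ^ v) / d\<close>, which is unavailable for \<open>d = 0\<close>, by a sum of products over \<open>j\<close>.\<close>
lemma power_card_telescope:
  fixes d :: "'a::comm_ring_1" and n :: nat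
  shows "(if \<exists>i<n. P i then d ^ (card {i. i < n \<and> P i} - 1) else 0) =
    (\<Sum>t<n. \<Prod>j<n. if j < t then (if P j then d else 1)
        else if j = t then (if P j then 1 else 0) else (if P j then 0 else 1))"
    (is "?L n = (\<Sum>t<n. \<Prod>j<n. ?h t j)")
proof (induction n)
  case (Suc n)
  have card: "card {i. i < Suc n \<and> P i} = card {i. i < n \<and> P i} + (if P n then 1 else 0)"
  proof -
    have "{i. i < Suc n \<and> P i} = (if P n then insert n {i. i < n \<and> P i} else {i. i < n \<and> P i})"
      by (auto simp: less_Suc_eq)
    then show ?thesis by simp
  qed
  have pd: "(\<Prod>j<n. if P j then d else 1) = d ^ card {i. i < n \<and> P i}" for n
  proof (induction n)
    case (Suc n)
    have "{i. i < Suc n \<and> P i} = (if P n then insert n {i. i < n \<and> P i} else {i. i < n \<and> P i})"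
      by (auto simp: less_Suc_eq)
    then show ?case using Suc by simp
  qed simp
  have "(\<Sum>t<Suc n. \<Prod>j<Suc n. ?h t j) =
     (\<Sum>t<n. (\<Prod>j<n. ?h t j) * (if P n then 0 else 1)) + (\<Prod>j<n. ?h n j) * (if P n then 1 else 0)"
    by simp
  also have "(\<Prod>j<n. ?h n j) = (\<Prod>j<n. if P j then d else 1)"
    by (intro prod.cong) auto
  also have "(\<Sum>t<n. (\<Prod>j<n. ?h t j) * (if P n then 0 else 1)) = ?L n * (if P n then 0 else 1)"
    unfolding Suc by (simp add: sum_distrib_right)
  also have "?L n * (if P n then 0 else 1) + (\<Prod>j<n. if P j then d else 1) * (if P n then 1 else 0) = ?L (Suc n)"
    unfolding pd card by (auto simp: less_Suc_eq)
  finally show ?case by simp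
qed simp

context pretzel
begin

text \<open>A state amounts to a free choice of the set of horizontal crossings in every column, so
  the sum distributes over the product.\<close>

lemma sum_states_prod:
  fixes f :: "nat \<Rightarrow> nat set \<Rightarrow> complex"
  shows "(\<Sum>s\<in>pstates ns. \<Prod>i<length ns. f i (hor s i)) =
    (\<Prod>i<length ns. \<Sum>B\<in>Pow {..<col_len ns i}. f i B)"
proof -
  let ?I = "{..<length ns}"
  let ?B = "\<lambda>i. Pow {..<col_len ns i}"
  let ?to = "\<lambda>s. \<lambda>i\<in>?I. hor s i"
  \<comment> \<open>Horizontal means \<open>s c \<noteq> tait_pos ns c\<close>, and this exclusive
    or is its own inverse.\<close>
  let ?from = "\<lambda>h. \<lambda>c\<in>pcrossings ns. (snd c \<in> h (fst c)) \<noteq> tait_pos ns c"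
  have hor_from: "hor (?from h) i = h i" if "h \<in> Pi\<^sub>E ?I ?B" "i < length ns" for h i
  proof -
    have "h i \<subseteq> {..<col_len ns i}" using that by (auto simp: PiE_iff)
    then show ?thesis using that(2) by (auto simp: hor_def)
  qed
  have "(\<Sum>s\<in>pstates ns. \<Prod>i<length ns. f i (hor s i)) = (\<Sum>h\<in>Pi\<^sub>E ?I ?B. \<Prod>i<length ns. f i (h i))"
  proof (rule sum.reindex_bij_witness[of _ ?from ?to])
    fix s assume s: "s \<in> pstates ns"
    show "?from (?to s) = s"
    proof (rule ext)
      fix c
      show "?from (?to s) c = s c"
        using s by (cases c) (auto simp: pstates_def PiE_iff extensional_def hor_def)
    qed
    show "?to s \<in> Pi\<^sub>E ?I ?B" by (auto simp: hor_def)
    show "(\<Prod>i<length ns. f i (?to s i)) = (\<Prod>i<length ns. f i (hor s i))" by simp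
  next
    fix h assume h: "h \<in> Pi\<^sub>E ?I ?B"
    show "?to (?from h) = h"
      by (rule ext) (use h hor_from[OF h] in \<open>auto simp: PiE_iff extensional_def restrict_def\<close>)
    show "?from h \<in> pstates ns" by (simp add: pstates_def)
  qed
  also have "\<dots> = (\<Prod>i<length ns. \<Sum>B\<in>?B i. f i B)"
    by (rule prod_sum_PiE[symmetric]) auto
  finally show ?thesis .
qed

text \<open>Truncated subtraction gives the empty set no loop factor.\<close>

definition smoothing_weight :: "complex \<Rightarrow> nat \<Rightarrow> nat set \<Rightarrow> complex" where
  "smoothing_weight A i B =
    (\<Prod>j<col_len ns i. if j \<in> B then inverse (tait_var A i) else tait_var A i) * loop_value A ^ (card B - 1)"

lemma sum_smoothing_weight:
  assumes "A \<noteq> 0"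
  shows "(\<Sum>B\<in>Pow {..<col_len ns i}. (if B = {} then x else y) * smoothing_weight A i B) =
    x * bars A i + y * cap A i"
proof -
  have "(\<Sum>B\<in>Pow {..<col_len ns i}. (if B = {} then x else y) * smoothing_weight A i B) =
    x * smoothing_weight A i {} +
    (\<Sum>B\<in>Pow {..<col_len ns i} - {{}}. (if B = {} then x else y) * smoothing_weight A i B)"
    by (subst sum.remove[of _ "{}"]) auto
  also have "smoothing_weight A i {} = bars A i" by (simp add: smoothing_weight_def bars_def)
  also have "(\<Sum>B\<in>Pow {..<col_len ns i} - {{}}. (if B = {} then x else y) * smoothing_weight A i B) =
    y * (\<Sum>B\<in>Pow {..<col_len ns i} - {{}}. smoothing_weight A i B)"
    unfolding sum_distrib_left by (rule sum.cong) auto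
  also have "(\<Sum>B\<in>Pow {..<col_len ns i} - {{}}. smoothing_weight A i B) = cap A i"
    using cap_weight_Pow[of "tait_var A i" "col_len ns i"] assms
    by (simp add: smoothing_weight_def cap_def)
  finally show ?thesis .
qed

lemma state_weight:
  assumes "A \<noteq> 0"
  shows "A powi (int (card {c\<in>pcrossings ns. s c}) - int (card {c\<in>pcrossings ns. \<not> s c})) =
    (\<Prod>i<length ns. \<Prod>j<col_len ns i. if j \<in> hor s i then inverse (tait_var A i) else tait_var A i)"
proof -
  have "A powi (int (card {c\<in>S. s c}) - int (card {c\<in>S. \<not> s c})) = (\<Prod>c\<in>S. if s c then A else inverse A)"
    if "finite S" for S
    using that assms by (simp add: prod.If_cases power_int_diff Collect_conj_eq Int_commute
        Collect_neg_eq Diff_eq power_inverse field_simps)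
  then have "A powi (int (card {c\<in>pcrossings ns. s c}) - int (card {c\<in>pcrossings ns. \<not> s c})) =
      (\<Prod>c\<in>pcrossings ns. if s c then A else inverse A)"
    by simp
  also have "\<dots> = (\<Prod>i<length ns. \<Prod>j<col_len ns i. if s (i, j) then A else inverse A)"
    unfolding pcrossings_Sigma by (subst prod.Sigma) (auto simp: split_def)
  also have "\<dots> = (\<Prod>i<length ns. \<Prod>j<col_len ns i. if j \<in> hor s i then inverse (tait_var A i) else tait_var A i)"
    by (intro prod.cong refl) (auto simp: hor_def tait_var_def tait_pos_def)
  finally show ?thesis .
qed

text \<open>The weight of a state is a product over the columns times
  \<open>loop_value A ^ (outer_loops s - 1)\<close>, which couples them. Rewritten with
  \<open>power_card_telescope\<close>, this factor becomes a sum of products over the columns, to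
  which \<open>sum_states_prod\<close> applies.\<close>

lemma kbracket_eq:
  assumes A: "A \<noteq> 0"
  shows "kbracket ns A = loop_value A * (\<Prod>i<length ns. cap A i) +
     (\<Sum>t<length ns. (\<Prod>j<t. cap A j + loop_value A * bars A j) * bars A t *
        (\<Prod>j\<in>{t<..<length ns}. cap A j))"
proof -
  let ?d = "loop_value A"
  let ?k = "length ns"
  let ?W = "smoothing_weight A"
  \<comment> \<open>Selects the states in which \<open>t\<close> is the last vertical column; each
    vertical column before it carries a factor \<open>?d\<close>.\<close>
  define h :: "nat \<Rightarrow> nat \<Rightarrow> nat set \<Rightarrow> complex" where "h = (\<lambda>t j B. if j < t then (if B = {} then ?d else 1)
      else if j = t then (if B = {} then 1 else 0) else (if B = {} then 0 else 1))"
  have split: "A powi (int (card {c\<in>pcrossings ns. s c}) - int (card {c\<in>pcrossings ns. \<not> s c}))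
      * (- (A ^ 2) - inverse (A ^ 2)) ^ (state_loops ns s - 1) =
    ?d * (\<Prod>i<?k. (if hor s i = {} then 0 else 1) * ?W i (hor s i)) +
    (\<Sum>t<?k. \<Prod>i<?k. h t i (hor s i) * ?W i (hor s i))" for s :: "crossing \<Rightarrow> bool"
  proof -
    let ?P = "\<lambda>i. hor s i = {}"
    have vert: "{i. i < ?k \<and> ?P i} = vert_cols s" by (auto simp: vert_cols_def)
    have "0 < outer_loops s" by (simp add: outer_loops_def card_gt_0_iff)
    then have "state_loops ns s - 1 = (\<Sum>i<?k. card (hor s i) - 1) + (outer_loops s - 1)"
      unfolding state_loops_eq by simp
    then have "A powi (int (card {c\<in>pcrossings ns. s c}) - int (card {c\<in>pcrossings ns. \<not> s c}))
      * ?d ^ (state_loops ns s - 1) = (\<Prod>i<?k. ?W i (hor s i)) * ?d ^ (outer_loops s - 1)"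
      unfolding state_weight[OF A] smoothing_weight_def prod.distrib
      by (simp add: power_add power_sum)
    \<comment> \<open>With no vertical column the exponent is 1, which is the first summand; with v
      > 0 of them it is v - 1, which is the second.\<close>
    also have "?d ^ (outer_loops s - 1) = ?d * (\<Prod>i<?k. if ?P i then 0 else 1) +
       (if \<exists>i<?k. ?P i then ?d ^ (card {i. i < ?k \<and> ?P i} - 1) else 0)"
    proof (cases "\<exists>i<?k. ?P i")
      case True
      then have "(\<Prod>i<?k. if ?P i then 0 else (1::complex)) = 0" by (intro prod_zero) auto
      moreover have "vert_cols s \<noteq> {}" using True by (auto simp: vert_cols_def)
      ultimately show ?thesis using True by (simp add: outer_loops_def vert)
    next
      case False
      then have "(\<Prod>i<?k. if ?P i then 0 else (1::complex)) = 1" by (intro prod.neutral) auto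
      moreover have "vert_cols s = {}" using False by (auto simp: vert_cols_def)
      ultimately show ?thesis unfolding if_not_P[OF False] by (simp add: outer_loops_def)
    qed
    also have "(if \<exists>i<?k. ?P i then ?d ^ (card {i. i < ?k \<and> ?P i} - 1) else 0) =
        (\<Sum>t<?k. \<Prod>i<?k. h t i (hor s i))"
      unfolding power_card_telescope h_def ..
    finally show ?thesis
      unfolding loop_value_def[symmetric]
      by (simp add: prod.distrib algebra_simps sum_distrib_left)
  qed
  have "kbracket ns A = ?d * (\<Sum>s\<in>pstates ns. \<Prod>i<?k. (if hor s i = {} then 0 else 1) * ?W i (hor s i)) +
      (\<Sum>t<?k. \<Sum>s\<in>pstates ns. \<Prod>i<?k. h t i (hor s i) * ?W i (hor s i))"
    unfolding kbracket_def split sum.distrib sum_distrib_left[symmetric]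
    by (subst sum.swap) (rule refl)
  also have "(\<Sum>s\<in>pstates ns. \<Prod>i<?k. (if hor s i = {} then 0 else 1) * ?W i (hor s i)) = (\<Prod>i<?k. cap A i)"
    using sum_states_prod[of "\<lambda>i B. (if B = {} then 0 else 1) * ?W i B"]
    by (simp only: sum_smoothing_weight[OF A]) simp
  also have "(\<Sum>t<?k. \<Sum>s\<in>pstates ns. \<Prod>i<?k. h t i (hor s i) * ?W i (hor s i)) =
    (\<Sum>t<?k. (\<Prod>j<t. cap A j + ?d * bars A j) * bars A t * (\<Prod>j\<in>{t<..<?k}. cap A j))"
  proof (rule sum.cong[OF refl])
    fix t assume "t \<in> {..<?k}"
    then have "{..<?k} = {..<t} \<union> ({t} \<union> {t<..<?k})" by auto
    have col: "(\<Sum>B\<in>Pow {..<col_len ns i}. h t i B * ?W i B) =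
       (if i < t then cap A i + ?d * bars A i else if i = t then bars A i else cap A i)" for i
      using sum_smoothing_weight[OF A, where i = i and x = ?d and y = 1]
        sum_smoothing_weight[OF A, where i = i and x = 1 and y = 0]
        sum_smoothing_weight[OF A, where i = i and x = 0 and y = 1]
      by (cases "i = t") (simp_all add: h_def add.commute)
    have "(\<Sum>s\<in>pstates ns. \<Prod>i<?k. h t i (hor s i) * ?W i (hor s i)) =
        (\<Prod>i<?k. if i < t then cap A i + ?d * bars A i else if i = t then bars A i else cap A i)"
      using sum_states_prod[of "\<lambda>i B. h t i B * ?W i B"] by (simp only: col)
    also have "\<dots> = (\<Prod>j<t. cap A j + ?d * bars A j) * (bars A t * (\<Prod>j\<in>{t<..<?k}. cap A j))"
      unfolding \<open>{..<?k} = {..<t} \<union> ({t} \<union> {t<..<?k})\<close>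
      by (subst prod.union_disjoint, simp, simp, force, subst prod.union_disjoint) (auto intro!: arg_cong2[where f = "(*)"] prod.cong)
    finally show "(\<Sum>s\<in>pstates ns. \<Prod>i<?k. h t i (hor s i) * ?W i (hor s i)) =
      (\<Prod>j<t. cap A j + ?d * bars A j) * bars A t * (\<Prod>j\<in>{t<..<?k}. cap A j)"
      by (simp add: mult.assoc)
  qed
  finally show ?thesis .
qed

end

section \<open>The determinant and the Jones polynomial\<close>

theorem mainTheorem6:
  fixes ns :: "int list" and out :: "dend \<Rightarrow> bool" and \<sigma> :: "nat \<Rightarrow> region"
  assumes "ns \<noteq> []"
    and "\<forall>x\<in>set ns. x \<noteq> 0"
    and "pretzel_is_knot ns"
    and "is_orientation ns out"
    and "bij_betw \<sigma> {..<ncross ns} (free_regions ns)"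
  shows "\<exists>s\<in>{1, -1 :: complex}. \<forall>A :: complex. A \<noteq> 0 \<longrightarrow>
           det (act_matrix ns out \<sigma> A) = s * jones_A ns out A"
proof -
  interpret pretzel ns using assms(1,2) by unfold_locales
  let ?C = "pcrossings ns"
  obtain s0 :: complex where s0: "s0 \<in> {1, -1}" and det: "\<And>F.
      det (mat (ncross ns) (ncross ns) (\<lambda>(i, j). F (crossing_of_num ns i) (\<sigma> j))) =
      s0 * leibniz_det ?C (\<lambda>x y. F x (region_of y))"
    using det_mat_eq_leibniz_det[OF bij_crossing_of_num assms(5) bij_region_of, where 'c = complex]
    by blast
  obtain f g where f: "\<And>c. f c \<in> {1, -1}" and g: "\<And>R. g R \<in> {1, -1}"
    and gauge: "\<And>c R. c \<in> ?C \<Longrightarrow> R \<in> free_regions ns \<Longrightarrow> incident ns c R \<Longrightarrow>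
       kappa ns out c R = f c * g R * base_sign c R"
    using kappa_gauge[OF assms(4)] by metis
  define e :: complex where
    "e = (\<Prod>i<length ns. (-1) ^ (col_len ns i - 1)) * (-1) ^ (length ns - 1)"
  \<comment> \<open>These signs depend on the diagram, its orientation and the enumerations but not
    on \<open>A\<close>, so one choice serves every \<open>A\<close>.\<close>
  define s where "s = s0 * (\<Prod>c\<in>?C. f c) * (\<Prod>c\<in>?C. g (region_of c)) * e"
  have unit_mult: "x * y \<in> {1, -1}" if "x \<in> {1, -1}" "y \<in> {1, -1}" for x y :: complex
    using that by auto
  have unit_power: "(-1) ^ n \<in> {1, -1 :: complex}" for n
    by (cases "even n") auto
  have "s \<in> {1, -1}"
    unfolding s_def e_def by (intro unit_mult s0 prod_signs f g unit_power)
  moreover have "det (act_matrix ns out \<sigma> A) = s * jones_A ns out A" if A: "A \<noteq> 0" for A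
  proof -
    have entry: "act_entry ns out A c (region_of y) =
        f c * w_val ns out c A * g (region_of y) * base_entry A c (region_of y)"
      if "c \<in> ?C" "y \<in> ?C" for c y
    proof -
      have "region_of y \<in> free_regions ns" using bij_region_of that(2) by (auto simp: bij_betw_def)
      then show ?thesis using gauge[OF that(1)] by (simp add: act_entry_def base_entry_def)
    qed
    have "det (act_matrix ns out \<sigma> A) = s0 * leibniz_det ?C (\<lambda>c y. act_entry ns out A c (region_of y))"
      unfolding act_matrix_def by (rule det)
    also have "leibniz_det ?C (\<lambda>c y. act_entry ns out A c (region_of y)) =
        leibniz_det ?C (\<lambda>c y. f c * w_val ns out c A * g (region_of y) * base_entry A c (region_of y))"
      by (rule leibniz_det_cong) (rule entry)
    \<comment> \<open>Rows carry \<open>f c\<close> and \<open>w_val\<close>, columns carry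
      \<open>g\<close>; the product of the \<open>w_val\<close> becomes the writhe normalisation of
      \<open>jones_A\<close>.\<close>
    also have "\<dots> = (\<Prod>c\<in>?C. f c * w_val ns out c A * g (region_of c)) *
        leibniz_det ?C (\<lambda>c y. base_entry A c (region_of y))"
      by (rule leibniz_det_scale)
    also have "leibniz_det ?C (\<lambda>c y. base_entry A c (region_of y)) = e * kbracket ns A"
      unfolding leibniz_det_base_entry[OF A] kbracket_eq[OF A] e_def ..
    finally show ?thesis
      unfolding jones_A_def prod_w_val[OF A, symmetric] s_def prod.distrib by (simp add: mult_ac)
  qed
  ultimately show ?thesis by blast
qed

end
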